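(* There exists a universal constant $C>0$ such that the following holds. Let $n\ge 2$ and let $x^\ast \in \mathbb{R}^n$ be a $\Delta$-separated signal with $s>0$ jump discontinuities, where $\Delta \geq 8s/n$. Let $u>0$ and let $A \in \mathbb{R}^{m\times n}$ be a standard Gaussian random matrix (i.i.d. $\mathcal{N}(0,1)$ entries) with $$ m \geq C\left(\Delta^{-1}\, s\log^2(n) + u^2\right).$$ Then with probability at least $1-e^{-u^2/2}$, the vector $x^\ast$ is the unique solution of the total variation minimization problem $$\min_{x\in\mathbb{R}^n} \|\nabla x\|_1 \quad \text{subject to } y = Ax,$$ where $y = Ax^\ast \in \mathbb{R}^m$.
   Context: The discrete gradient operator $\nabla \in \mathbb{R}^{(n-1)\times n}$ is the forward-difference operator: $(\nabla x)_i = x_{i+1}-x_i$ for $i=1,\dots,n-1$. A signal $x^\ast\in\mathbb{R}^n$ has $s$ jump discontinuities if $\operatorname{supp}(\nabla x^\ast)=\{\nu_1,\dots,\nu_s\}$ with $0 =: \nu_0 < \nu_1<\dots<\nu_s<\nu_{s+1}:=n$. Such a signal is called $\Delta$-separated, for a separation constant $\Delta>0$, if $\min_{i\in\{1,\dots,s+1\}} \frac{|\nu_i-\nu_{i-1}|}{n} \geq \frac{\Delta}{s+1}$. *)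

theory Defs
  imports "HOL-Probability.Probability"
begin

(* Signals x in R^n are represented as functions nat => real, only the
   values at indices 0..n-1 matter (0-based indexing; paper uses 1..n). *)

(* Jump set in the paper's 1-based convention: nu in {1..n-1} is a jump iff
   (grad x)_nu = x_{nu+1} - x_nu ~= 0 (1-based), i.e. x nu ~= x (nu-1) (0-based). *)
definition jumps :: "nat \<Rightarrow> (nat \<Rightarrow> real) \<Rightarrow> nat set" where
  "jumps n x = {\<nu> \<in> {1..<n}. x \<nu> \<noteq> x (\<nu> - 1)}"

(* Delta-separated: with nu_0 = 0, nu_{s+1} = n, every gap between consecutive
   points nu_{i-1} < nu_i satisfies (nu_i - nu_{i-1})/n >= Delta/(s+1). *)
definition delta_separated :: "nat \<Rightarrow> real \<Rightarrow> (nat \<Rightarrow> real) \<Rightarrow> bool" where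
  "delta_separated n \<Delta> x \<longleftrightarrow>
     (let P = jumps n x \<union> {0, n}; s = card (jumps n x) in
      \<forall>a\<in>P. \<forall>b\<in>P. a < b \<and> (\<forall>c\<in>P. \<not> (a < c \<and> c < b)) \<longrightarrow>
         (real b - real a) / real n \<ge> \<Delta> / (real s + 1))"

definition tv_norm :: "nat \<Rightarrow> (nat \<Rightarrow> real) \<Rightarrow> real" where
  "tv_norm n x = (\<Sum>i<n - 1. \<bar>x (Suc i) - x i\<bar>)"

definition matvec :: "nat \<Rightarrow> nat \<Rightarrow> (nat \<times> nat \<Rightarrow> real) \<Rightarrow> (nat \<Rightarrow> real) \<Rightarrow> nat \<Rightarrow> real" where
  "matvec m n A x = (\<lambda>i. if i < m then (\<Sum>j<n. A (i, j) * x j) else 0)"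

definition unique_tv_minimizer :: "nat \<Rightarrow> nat \<Rightarrow> (nat \<times> nat \<Rightarrow> real) \<Rightarrow> (nat \<Rightarrow> real) \<Rightarrow> bool" where
  "unique_tv_minimizer m n A xs \<longleftrightarrow>
     (\<forall>x. matvec m n A x = matvec m n A xs \<and> (\<exists>j<n. x j \<noteq> xs j)
          \<longrightarrow> tv_norm n xs < tv_norm n x)"

definition gaussian_matrix :: "nat \<Rightarrow> nat \<Rightarrow> (nat \<times> nat \<Rightarrow> real) measure" where
  "gaussian_matrix m n = PiM ({..<m} \<times> {..<n}) (\<lambda>_. density lborel std_normal_density)"

end

(* Write h = x - xs for a competitor x with tv_norm n x <= tv_norm n xs, so h is a descent direction.
   Test the descent inequality with the dual vector v that equals the sign of the jump at each jump
   and decays like 1 - sqrt (d / L) with the distance d to it, L being a quarter of the minimal gap.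
   Since the increments of v have energy O(s log n / L), this bounds the gradient of h away from the
   jumps in the weight sqrt d.  Cutting {0..<n} at dyadic distances from the jumps and on a grid of
   width L, h becomes a combination of n normalised indicator functions of intervals whose
   coefficients have l1-norm at most sqrt R * norm h, with R = O(s log n / Delta).
   Maurey's empirical method, applied to the indefinite form q(x) = norm(A x)^2 - m/8 norm(x)^2, shows
   that no such h lies in the kernel of A if q >= 0 on all sums of k = O(R) signed atoms and
   norm(A a)^2 <= 4 m for the atoms a.  These are finitely many events, so chi-square tail bounds and
   a union bound over (2 n)^k + n of them suffice; no Gaussian comparison inequality is needed. *)
theory Submission
  imports Defs
begin

section \<open>Gaussian matrices\<close>

text \<open>The square root in the dual vector is forced from two sides. A block at distance d from
  the jumps may have length d, so an atom starting there has norm up to sqrt d, and the gap 1 - |v|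
  must be at least of order sqrt (d / L). A power d^a with a > 1/2 is too small near the jumps; for
  a < 1/2 the energy per jump grows to order L^(-2a), compared with log n / L. At a = 1/2 the factor
  sqrt L of the weight cancels against the energy, so L enters R only through the n / L grid cuts,
  the origin of 1 / \<Delta>. One logarithm comes from the dyadic cuts and the harmonic energy sum,
  the other from the cost ln (2 n) of each of the k atoms in the union bound. The indefinite q suits
  Maurey's method because a kernel vector makes q negative: k copies of the mean scale this by k^2,
  while replacing means by atoms costs only a variance term of order k m. Since
  \<open>measure\<close> is 0 on nonmeasurable sets, the recovery event, a condition on uncountably
  many competitors, must also be proved measurable.\<close>

definition norm_sq :: "nat \<Rightarrow> (nat \<Rightarrow> real) \<Rightarrow> real" where
  "norm_sq n x = (\<Sum>j<n. (x j)\<^sup>2)"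

definition img_sq :: "nat \<Rightarrow> nat \<Rightarrow> (nat \<times> nat \<Rightarrow> real) \<Rightarrow> (nat \<Rightarrow> real) \<Rightarrow> real" where
  "img_sq m n A x = (\<Sum>r<m. (\<Sum>j<n. A (r, j) * x j)\<^sup>2)"

lemma prob_space_std_normal: "prob_space (density lborel std_normal_density)"
  by (rule prob_space_normal_density) simp

lemma prob_space_gaussian_matrix: "prob_space (gaussian_matrix m n)"
  unfolding gaussian_matrix_def by (intro prob_space_PiM prob_space_std_normal)

lemma entry_measurable [measurable]:
  "i \<in> {..<m} \<times> {..<n} \<Longrightarrow> (\<lambda>A. A i) \<in> borel_measurable (gaussian_matrix m n)"
  unfolding gaussian_matrix_def
  by (rule measurable_compose[OF measurable_component_singleton]) auto

lemma img_sq_measurable [measurable]: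
  "(\<lambda>A. img_sq m n A x) \<in> borel_measurable (gaussian_matrix m n)"
  unfolding img_sq_def
  by (intro borel_measurable_sum borel_measurable_power borel_measurable_times entry_measurable) auto

lemma indep_entries:
  assumes "0 < m" "0 < n"
  shows "prob_space.indep_vars (gaussian_matrix m n) (\<lambda>_. borel) (\<lambda>i A. A i) ({..<m} \<times> {..<n})"
proof -
  interpret P: prob_space "gaussian_matrix m n" by (rule prob_space_gaussian_matrix)
  let ?N = "density lborel std_normal_density"
  let ?I = "{..<m} \<times> {..<n}"
  have dc: "distr (gaussian_matrix m n) borel (\<lambda>A. A i) = ?N" if "i \<in> ?I" for i
  proof -
    have "distr (gaussian_matrix m n) borel (\<lambda>A. A i) = distr (gaussian_matrix m n) ?N (\<lambda>A. A i)"
      by (rule distr_cong) auto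
    also have "\<dots> = ?N" unfolding gaussian_matrix_def
      using that by (intro distr_PiM_component prob_space_std_normal) auto
    finally show ?thesis .
  qed
  have "distr (gaussian_matrix m n) (PiM ?I (\<lambda>_. borel)) (\<lambda>x. \<lambda>i\<in>?I. x i)
      = distr (gaussian_matrix m n) (PiM ?I (\<lambda>_. ?N)) (\<lambda>x. x)"
    by (rule distr_cong) (auto simp: gaussian_matrix_def space_PiM PiE_def extensional_restrict intro!: sets_PiM_cong)
  also have "\<dots> = PiM ?I (\<lambda>_. ?N)"
    unfolding gaussian_matrix_def by (rule distr_id)
  also have "\<dots> = PiM ?I (\<lambda>i. distr (gaussian_matrix m n) borel (\<lambda>A. A i))"
    using dc by (intro PiM_cong) auto
  finally show ?thesis
    using assms by (subst P.indep_vars_iff_distr_eq_PiM') auto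
qed

lemma entry_distributed:
  assumes "i \<in> {..<m} \<times> {..<n}"
  shows "distributed (gaussian_matrix m n) lborel (\<lambda>A. A i) std_normal_density"
proof -
  let ?N = "density lborel std_normal_density"
  have "distr (gaussian_matrix m n) lborel (\<lambda>A. A i) = distr (gaussian_matrix m n) ?N (\<lambda>A. A i)"
    by (rule distr_cong) auto
  also have "\<dots> = ?N" unfolding gaussian_matrix_def
    using assms by (intro distr_PiM_component prob_space_std_normal) auto
  finally show ?thesis
    using assms by (auto simp: distributed_def)
qed

lemma row_indep:
  assumes "0 < m" "0 < n"
  shows "prob_space.indep_vars (gaussian_matrix m n) (\<lambda>_. borel)
    (\<lambda>r A. \<Sum>j<n. A (r, j) * x j) {..<m}"
proof -
  interpret P: prob_space "gaussian_matrix m n" by (rule prob_space_gaussian_matrix)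
  \<comment> \<open>Distinct rows use disjoint blocks of entries; the restrictions make this visible
    to the independence lemmas.\<close>
  have 1: "P.indep_vars (\<lambda>r. PiM ({r} \<times> {..<n}) (\<lambda>_. borel :: real measure))
     (\<lambda>r A. restrict (\<lambda>i. A i) ({r} \<times> {..<n})) {..<m}"
    by (rule P.indep_vars_restrict[OF indep_entries[OF assms]]) (auto simp: disjoint_family_on_def)
  have 2: "P.indep_vars (\<lambda>_. borel)
     (\<lambda>r A. \<Sum>j<n. restrict (\<lambda>i. A i) ({r} \<times> {..<n}) (r, j) * x j) {..<m}"
    by (rule P.indep_vars_compose2[OF 1])
       (intro borel_measurable_sum borel_measurable_times measurable_component_singleton borel_measurable_const; auto)
  then show ?thesis by simp
qed

lemma row_distributed:
  assumes r: "r < m" and x: "norm_sq n x = 1"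
  shows "distributed (gaussian_matrix m n) lborel (\<lambda>A. \<Sum>j<n. A (r, j) * x j) std_normal_density"
proof -
  interpret P: prob_space "gaussian_matrix m n" by (rule prob_space_gaussian_matrix)
  \<comment> \<open>Zero coefficients are removed because \<open>sum_indep_normal\<close> asks for
    positive deviations and a nonempty index set.\<close>
  define J where "J = {j\<in>{..<n}. x j \<noteq> 0}"
  have "n > 0" using x by (cases n) (auto simp: norm_sq_def)
  have "J \<noteq> {}"
  proof
    assume "J = {}"
    then have "norm_sq n x = 0" by (auto simp: norm_sq_def J_def)
    with x show False by simp
  qed
  have "finite J" by (simp add: J_def)
  have ind0: "P.indep_vars (\<lambda>_. borel) (\<lambda>i A. A i) ((\<lambda>j. (r,j)) ` J)"
    by (rule P.indep_vars_subset[OF indep_entries]) (use r \<open>n>0\<close> in \<open>auto simp: J_def\<close>)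
  have 1: "P.indep_vars (\<lambda>j. PiM {(r,j)} (\<lambda>_. borel :: real measure))
     (\<lambda>j A. restrict (\<lambda>i. A i) {(r,j)}) J"
    by (rule P.indep_vars_restrict[OF ind0]) (auto simp: disjoint_family_on_def)
  have "P.indep_vars (\<lambda>_. borel) (\<lambda>j A. restrict (\<lambda>i. A i) {(r,j)} (r, j) * x j) J"
    by (rule P.indep_vars_compose2[OF 1])
       (intro borel_measurable_times measurable_component_singleton borel_measurable_const; auto)
  then have ind: "P.indep_vars (\<lambda>_. borel) (\<lambda>j A. A (r, j) * x j) J" by simp
  have "distributed (gaussian_matrix m n) lborel (\<lambda>A. \<Sum>j\<in>J. A (r, j) * x j)
     (normal_density (\<Sum>j\<in>J. 0) (sqrt (\<Sum>j\<in>J. \<bar>x j\<bar>\<^sup>2)))"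
  proof (rule P.sum_indep_normal[OF \<open>finite J\<close> \<open>J \<noteq> {}\<close> ind])
    fix j assume j: "j \<in> J"
    then show "0 < \<bar>x j\<bar>" by (simp add: J_def)
    have "distributed (gaussian_matrix m n) lborel (\<lambda>A. 0 + x j * A (r, j)) (normal_density (0 + x j * 0) (\<bar>x j\<bar> * 1))"
      by (rule P.normal_density_affine) (use j r entry_distributed in \<open>auto simp: J_def\<close>)
    then show "distributed (gaussian_matrix m n) lborel (\<lambda>A. A (r, j) * x j) (normal_density 0 \<bar>x j\<bar>)"
      by (simp add: mult.commute)
  qed
  moreover have "(\<Sum>j\<in>J. \<bar>x j\<bar>\<^sup>2) = 1"
    unfolding x[symmetric] norm_sq_def J_def by (simp, rule sum.mono_neutral_left) auto
  moreover have "(\<Sum>j\<in>J. A (r, j) * x j) = (\<Sum>j<n. A (r, j) * x j)" for A :: "nat \<times> nat \<Rightarrow> real"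
    unfolding J_def by (rule sum.mono_neutral_left) auto
  ultimately show ?thesis by simp
qed

section \<open>Exponential moments and chi-square tails\<close>

lemma nn_integral_exp_square_normal:
  assumes "\<sigma> > 0" "b = (1 - 1 / \<sigma>\<^sup>2) / 2"
  shows "(\<integral>\<^sup>+x. ennreal (std_normal_density x) * ennreal (exp (b * x\<^sup>2)) \<partial>lborel) = ennreal \<sigma>"
proof -
  \<comment> \<open>Tilting by exp (b x^2) turns the standard density into \<sigma> times a centred
    normal density of deviation \<sigma>. Thus \<sigma> = (1 - 2 b)^(-1/2), and b is negative or
    positive according to \<sigma> < 1 or \<sigma> > 1.\<close>
  have "std_normal_density x * exp (b * x\<^sup>2) = \<sigma> * normal_density 0 \<sigma> x" for x
  proof -
    have "- x\<^sup>2 / 2 + b * x\<^sup>2 = - x\<^sup>2 / (2 * \<sigma>\<^sup>2)"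
      using assms(1) unfolding assms(2) by (simp add: field_simps)
    then have "exp (- x\<^sup>2 / 2) * exp (b * x\<^sup>2) = exp (- x\<^sup>2 / (2 * \<sigma>\<^sup>2))"
      by (simp add: exp_add[symmetric])
    then show ?thesis
      using assms(1) by (simp add: normal_density_def std_normal_density_def real_sqrt_mult field_simps)
  qed
  then have "(\<integral>\<^sup>+x. ennreal (std_normal_density x) * ennreal (exp (b * x\<^sup>2)) \<partial>lborel)
     = (\<integral>\<^sup>+x. ennreal \<sigma> * ennreal (normal_density 0 \<sigma> x) \<partial>lborel)"
    using assms(1) by (simp add: ennreal_mult'[symmetric])
  also have "\<dots> = ennreal \<sigma> * (\<integral>\<^sup>+x. ennreal (normal_density 0 \<sigma> x) \<partial>lborel)"
    by (rule nn_integral_cmult) simp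
  also have "(\<integral>\<^sup>+x. ennreal (normal_density 0 \<sigma> x) \<partial>lborel) = 1"
    using assms(1) by (subst nn_integral_eq_integral) auto
  finally show ?thesis by simp
qed

lemma nn_integral_exp_img_sq:
  assumes "0 < m" and x: "norm_sq n x = 1" and \<sigma>: "\<sigma> > 0" "b = (1 - 1 / \<sigma>\<^sup>2) / 2"
  shows "(\<integral>\<^sup>+A. ennreal (exp (b * img_sq m n A x)) \<partial>gaussian_matrix m n) = ennreal (\<sigma> ^ m)"
proof -
  interpret P: prob_space "gaussian_matrix m n" by (rule prob_space_gaussian_matrix)
  have "n > 0" using x by (cases n) (auto simp: norm_sq_def)
  have ind: "P.indep_vars (\<lambda>_. borel) (\<lambda>r A. ennreal (exp (b * (\<Sum>j<n. A (r, j) * x j)\<^sup>2))) {..<m}"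
    by (rule P.indep_vars_compose2[OF row_indep]) (use assms \<open>n>0\<close> in auto)
  have "(\<integral>\<^sup>+A. ennreal (exp (b * img_sq m n A x)) \<partial>gaussian_matrix m n)
      = (\<integral>\<^sup>+A. (\<Prod>r<m. ennreal (exp (b * (\<Sum>j<n. A (r, j) * x j)\<^sup>2))) \<partial>gaussian_matrix m n)"
    by (simp add: img_sq_def sum_distrib_left exp_sum prod_ennreal)
  also have "\<dots> = (\<Prod>r<m. \<integral>\<^sup>+A. ennreal (exp (b * (\<Sum>j<n. A (r, j) * x j)\<^sup>2)) \<partial>gaussian_matrix m n)"
    by (rule P.indep_vars_nn_integral[OF _ ind]) auto
  also have "\<dots> = (\<Prod>r<m. ennreal \<sigma>)"
  proof (rule prod.cong[OF refl])
    fix r assume "r \<in> {..<m}"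
    then have "r < m" by simp
    from distributed_nn_integral[OF row_distributed[OF this x], of "\<lambda>y. ennreal (exp (b * y\<^sup>2))"]
    show "(\<integral>\<^sup>+A. ennreal (exp (b * (\<Sum>j<n. A (r, j) * x j)\<^sup>2)) \<partial>gaussian_matrix m n) = ennreal \<sigma>"
      using nn_integral_exp_square_normal[OF \<sigma>] by simp
  qed
  finally show ?thesis using \<sigma>(1) by (simp add: ennreal_power)
qed

text \<open>Chernoff's bound for both tails at once: the event is an upper tail for b > 0 and a
  lower tail for b < 0. After Markov's inequality each row contributes \<sigma> exp (- b c), which
  the last hypothesis makes at most exp (-1/2).\<close>

lemma img_sq_tail:
  assumes "0 < m" and x: "norm_sq n x = 1" and \<sigma>: "\<sigma> > 0" "b = (1 - 1 / \<sigma>\<^sup>2) / 2"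
    and c: "\<sigma> \<le> exp (b * c - 1 / 2)"
  shows "measure (gaussian_matrix m n) {A \<in> space (gaussian_matrix m n). b * img_sq m n A x \<ge> b * c * m}
     \<le> exp (- real m / 2)"
proof -
  interpret P: prob_space "gaussian_matrix m n" by (rule prob_space_gaussian_matrix)
  let ?M = "gaussian_matrix m n"
  have "emeasure ?M {A \<in> space ?M. b * img_sq m n A x \<ge> b * c * m}
      \<le> emeasure ?M ({A \<in> space ?M. 1 \<le> ennreal (exp (- (b * c * m))) * ennreal (exp (b * img_sq m n A x))} \<inter> space ?M)"
    by (rule emeasure_mono) (auto simp: ennreal_mult'[symmetric] exp_add[symmetric])
  also have "\<dots> \<le> ennreal (exp (- (b * c * m))) * (\<integral>\<^sup>+A. ennreal (exp (b * img_sq m n A x)) * indicator (space ?M) A \<partial>?M)"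
    by (rule order.trans[OF _ nn_integral_Markov_inequality]) (auto intro!: emeasure_mono)
  also have "(\<integral>\<^sup>+A. ennreal (exp (b * img_sq m n A x)) * indicator (space ?M) A \<partial>?M)
      = (\<integral>\<^sup>+A. ennreal (exp (b * img_sq m n A x)) \<partial>?M)"
    by (rule nn_integral_cong) simp
  also have "\<dots> = ennreal (\<sigma> ^ m)" by (rule nn_integral_exp_img_sq[OF assms(1-4)])
  also have "ennreal (exp (- (b * c * m))) * ennreal (\<sigma> ^ m) \<le> ennreal (exp (- real m / 2))"
  proof -
    have "\<sigma> ^ m \<le> exp (b * c - 1 / 2) ^ m" using c \<sigma>(1) by (intro power_mono) auto
    also have "\<dots> = exp (m * (b * c - 1 / 2))" by (rule exp_of_nat_mult[symmetric])
    finally have "exp (- (b * c * m)) * \<sigma> ^ m \<le> exp (- (b * c * m)) * exp (m * (b * c - 1 / 2))"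
      by (intro mult_left_mono) auto
    also have "\<dots> = exp (- real m / 2)" by (simp add: exp_add[symmetric] algebra_simps)
    finally show ?thesis by (simp add: ennreal_mult'[symmetric])
  qed
  finally show ?thesis by (simp add: P.emeasure_eq_measure)
qed

lemma img_sq_lower_tail:
  assumes "0 < m" "norm_sq n x = 1"
  shows "measure (gaussian_matrix m n) {A \<in> space (gaussian_matrix m n). img_sq m n A x \<le> m / 8} \<le> exp (- real m / 2)"
proof -
  have "exp (1::real) \<le> 3" by (rule exp_le)
  then have "exp (-1::real) \<ge> 1 / 3" by (simp add: exp_minus field_simps)
  \<comment> \<open>The choice \<sigma> = 1/3 gives b = -4; with c = 1/8 the requirement reads 1/3
    \<le> exp (-1).\<close>
  then have "(1/3::real) \<le> exp ((-4) * (1/8) - 1/2)" by simp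
  from img_sq_tail[OF assms _ _ this] show ?thesis by (simp add: power2_eq_square mult.commute)
qed

lemma img_sq_upper_tail:
  assumes "0 < m" "norm_sq n x = 1"
  shows "measure (gaussian_matrix m n) {A \<in> space (gaussian_matrix m n). img_sq m n A x \<ge> 4 * m} \<le> exp (- real m / 2)"
proof -
  have "sqrt 2 \<le> 1 + 1 / (2::real)" by (rule real_le_lsqrt) (auto simp: power2_eq_square)
  also have "\<dots> \<le> exp (1/2)" by (rule exp_ge_add_one_self)
  \<comment> \<open>The choice \<sigma> = sqrt 2 gives b = 1/4; with c = 4 the requirement reads
    sqrt 2 \<le> exp (1/2).\<close>
  finally have "sqrt 2 \<le> exp ((1/4) * 4 - 1/2)" by simp
  from img_sq_tail[OF assms _ _ this] show ?thesis by (simp add: mult.commute)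
qed

section \<open>Kernels and atomic decompositions\<close>

lemma ex_le_weighted_mean:
  fixes p f :: "'i \<Rightarrow> real"
  assumes "finite I" "\<And>i. i \<in> I \<Longrightarrow> 0 \<le> p i" "(\<Sum>i\<in>I. p i) = 1"
  shows "\<exists>i\<in>I. f i \<le> (\<Sum>i\<in>I. p i * f i)"
proof (rule ccontr)
  assume "\<not> ?thesis"
  then have *: "f i > (\<Sum>i\<in>I. p i * f i)" if "i \<in> I" for i using that by auto
  obtain i0 where i0: "i0 \<in> I" "p i0 \<noteq> 0" using assms(3) by (metis sum.neutral zero_neq_one)
  let ?s = "\<Sum>i\<in>I. p i * f i"
  have "(\<Sum>i\<in>I. p i * ?s) < (\<Sum>i\<in>I. p i * f i)"
  proof (rule sum_strict_mono_ex1[OF assms(1)])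
    show "\<forall>i\<in>I. p i * ?s \<le> p i * f i"
      using * assms(2) by (auto intro!: mult_left_mono simp: less_imp_le)
    show "\<exists>i\<in>I. p i * ?s < p i * f i"
      using i0 * assms(2)[of i0] by (intro bexI[of _ i0] mult_strict_left_mono) auto
  qed
  then show False using assms(3) by (simp add: sum_distrib_right[symmetric])
qed

text \<open>Maurey's empirical method: \<open>q\<close> need not be nonnegative, it only has to behave like a
  quadratic form under averaging over the \<open>\<xi> i\<close>.\<close>

lemma maurey_choice:
  fixes p :: "'i \<Rightarrow> real" and q :: "('j \<Rightarrow> real) \<Rightarrow> real"
  assumes I: "finite I" "\<And>i. i \<in> I \<Longrightarrow> 0 \<le> p i" "(\<Sum>i\<in>I. p i) = 1"
    and q: "\<And>y. (\<Sum>i\<in>I. p i * q (\<lambda>j. y j + \<xi> i j)) = q (\<lambda>j. y j + \<mu> j) + \<sigma>"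
  shows "\<exists>is. length is = k \<and> set is \<subseteq> I \<and>
    q (\<lambda>j. y j + (\<Sum>i\<leftarrow>is. \<xi> i j)) \<le> q (\<lambda>j. y j + real k * \<mu> j) + real k * \<sigma>"
proof (induction k arbitrary: y)
  case 0
  show ?case by (intro exI[of _ "[]"]) simp
next
  case (Suc k)
  \<comment> \<open>While one atom is chosen, the k draws still to come are represented by their
    mean; the induction hypothesis then replaces that mean by atoms.\<close>
  from ex_le_weighted_mean[OF I, of "\<lambda>i. q (\<lambda>j. (y j + real k * \<mu> j) + \<xi> i j)"]
  obtain i where i: "i \<in> I" "q (\<lambda>j. (y j + real k * \<mu> j) + \<xi> i j)
      \<le> q (\<lambda>j. (y j + real k * \<mu> j) + \<mu> j) + \<sigma>"
    unfolding q by auto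
  from Suc[of "\<lambda>j. y j + \<xi> i j"] obtain is' where is': "length is' = k" "set is' \<subseteq> I"
    "q (\<lambda>j. (y j + \<xi> i j) + (\<Sum>i\<leftarrow>is'. \<xi> i j)) \<le> q (\<lambda>j. (y j + \<xi> i j) + real k * \<mu> j) + real k * \<sigma>"
    by auto
  have "q (\<lambda>j. y j + (\<Sum>i\<leftarrow>i # is'. \<xi> i j)) \<le> q (\<lambda>j. y j + real (Suc k) * \<mu> j) + real (Suc k) * \<sigma>"
    using i(2) is'(3) by (simp add: algebra_simps)
  then show ?case using i is' by (intro exI[of _ "i # is'"]) auto
qed

text \<open>Mean square equals square of the mean plus variance. The variance does not involve a, so
  the error term of \<open>maurey_choice\<close> is the same for every y.\<close>

lemma weighted_square_shift:
  fixes p b :: "'i \<Rightarrow> real"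
  assumes "(\<Sum>i\<in>I. p i) = 1"
  shows "(\<Sum>i\<in>I. p i * (a + b i)\<^sup>2)
    = (a + (\<Sum>i\<in>I. p i * b i))\<^sup>2 + ((\<Sum>i\<in>I. p i * (b i)\<^sup>2) - (\<Sum>i\<in>I. p i * b i)\<^sup>2)"
proof -
  have "(\<Sum>i\<in>I. p i * (a + b i)\<^sup>2) = (\<Sum>i\<in>I. p i * a\<^sup>2 + (2 * a * (p i * b i) + p i * (b i)\<^sup>2))"
    by (rule sum.cong) (auto simp: power2_eq_square algebra_simps)
  also have "\<dots> = a\<^sup>2 + (2 * a * (\<Sum>i\<in>I. p i * b i) + (\<Sum>i\<in>I. p i * (b i)\<^sup>2))"
    using assms by (simp add: sum.distrib sum_distrib_left[symmetric] sum_distrib_right[symmetric])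
  finally show ?thesis by (simp add: power2_eq_square algebra_simps)
qed

lemma norm_sq_average:
  fixes p :: "'i \<Rightarrow> real"
  assumes "(\<Sum>i\<in>I. p i) = 1" and \<mu>: "\<And>j. \<mu> j = (\<Sum>i\<in>I. p i * \<xi> i j)"
  shows "(\<Sum>i\<in>I. p i * norm_sq n (\<lambda>j. y j + \<xi> i j))
    = norm_sq n (\<lambda>j. y j + \<mu> j) + ((\<Sum>i\<in>I. p i * norm_sq n (\<xi> i)) - norm_sq n \<mu>)"
proof -
  have "(\<Sum>i\<in>I. p i * norm_sq n (\<lambda>j. y j + \<xi> i j)) = (\<Sum>j<n. \<Sum>i\<in>I. p i * (y j + \<xi> i j)\<^sup>2)"
    unfolding norm_sq_def sum_distrib_left by (rule sum.swap)
  also have "\<dots> = (\<Sum>j<n. (y j + \<mu> j)\<^sup>2) + ((\<Sum>j<n. \<Sum>i\<in>I. p i * (\<xi> i j)\<^sup>2) - (\<Sum>j<n. (\<mu> j)\<^sup>2))"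
    unfolding weighted_square_shift[OF assms(1)] \<mu> by (simp add: sum.distrib sum_subtractf)
  also have "(\<Sum>j<n. \<Sum>i\<in>I. p i * (\<xi> i j)\<^sup>2) = (\<Sum>i\<in>I. p i * norm_sq n (\<xi> i))"
    unfolding norm_sq_def sum_distrib_left by (rule sum.swap)
  finally show ?thesis by (simp add: norm_sq_def)
qed

lemma img_sq_conv_norm_sq: "img_sq m n A x = norm_sq m (\<lambda>r. \<Sum>j<n. A (r, j) * x j)"
  by (simp add: img_sq_def norm_sq_def)

lemma img_sq_average:
  fixes p :: "'i \<Rightarrow> real"
  assumes "(\<Sum>i\<in>I. p i) = 1" and \<mu>: "\<And>j. \<mu> j = (\<Sum>i\<in>I. p i * \<xi> i j)"
  shows "(\<Sum>i\<in>I. p i * img_sq m n A (\<lambda>j. y j + \<xi> i j))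
    = img_sq m n A (\<lambda>j. y j + \<mu> j) + ((\<Sum>i\<in>I. p i * img_sq m n A (\<xi> i)) - img_sq m n A \<mu>)"
proof -
  have "(\<Sum>j<n. A (r, j) * \<mu> j) = (\<Sum>i\<in>I. p i * (\<Sum>j<n. A (r, j) * \<xi> i j))" for r
    unfolding \<mu> sum_distrib_left by (subst sum.swap) (simp add: ac_simps)
  from norm_sq_average[OF assms(1), of "\<lambda>r. \<Sum>j<n. A (r, j) * \<mu> j", OF this,
      of m "\<lambda>r. \<Sum>j<n. A (r, j) * y j"]
  show ?thesis unfolding img_sq_conv_norm_sq by (simp add: distrib_left sum.distrib)
qed

lemma norm_sq_scale: "norm_sq n (\<lambda>j. a * x j) = a\<^sup>2 * norm_sq n x"
  by (simp add: norm_sq_def power_mult_distrib sum_distrib_left)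

lemma img_sq_scale: "img_sq m n A (\<lambda>j. a * x j) = a\<^sup>2 * img_sq m n A x"
proof -
  have "(\<Sum>j<n. A (r, j) * (a * x j)) = a * (\<Sum>j<n. A (r, j) * x j)" for r
    by (simp add: sum_distrib_left ac_simps)
  then show ?thesis by (simp only: img_sq_conv_norm_sq norm_sq_scale)
qed

definition signed_combination :: "('i \<Rightarrow> nat \<Rightarrow> real) \<Rightarrow> ('i \<times> real) list \<Rightarrow> nat \<Rightarrow> real" where
  "signed_combination \<psi> ps j = (\<Sum>(i, e)\<leftarrow>ps. e * \<psi> i j)"

lemma norm_sq_cong: "(\<And>j. j < n \<Longrightarrow> x j = y j) \<Longrightarrow> norm_sq n x = norm_sq n y"
  by (simp add: norm_sq_def)

lemma img_sq_cong: "(\<And>j. j < n \<Longrightarrow> x j = y j) \<Longrightarrow> img_sq m n A x = img_sq m n A y"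
  by (simp add: img_sq_def)

lemma norm_sq_nonneg: "norm_sq n x \<ge> 0"
  unfolding norm_sq_def by (intro sum_nonneg) simp

text \<open>Let s be the l1-norm of c and w = norm_sq h / s^2. For h in the kernel, the mean h / s
  of the signed atoms has q-value - m w / 8. Maurey's choice then yields a sum of k signed atoms
  with q at most - k^2 m w / 8 + k (4 m + m w / 8), which is k m / 8 times 32 - (k - 1) w.
  Nonnegativity of q forces (k - 1) w \<le> 32, against w \<ge> 1 / R. The 32 is the ratio of the
  bounds 4 m and m / 8.\<close>

lemma kernel_avoids_atomic_ball:
  fixes \<psi> :: "'i \<Rightarrow> nat \<Rightarrow> real" and c :: "'i \<Rightarrow> real"
  assumes I: "finite I"
    and lower: "\<And>ps. length ps = k \<Longrightarrow> set ps \<subseteq> I \<times> {-1, 1} \<Longrightarrow>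
      img_sq m n A (signed_combination \<psi> ps) \<ge> real m / 8 * norm_sq n (signed_combination \<psi> ps)"
    and upper: "\<And>i. i \<in> I \<Longrightarrow> img_sq m n A (\<psi> i) \<le> 4 * real m"
    and h: "\<And>j. j < n \<Longrightarrow> h j = (\<Sum>i\<in>I. c i * \<psi> i j)"
    and c: "(\<Sum>i\<in>I. \<bar>c i\<bar>)\<^sup>2 \<le> R * norm_sq n h"
    and k: "32 * R < real k - 1" "0 < k" and "0 < m" and h0: "norm_sq n h > 0"
  shows "img_sq m n A h \<noteq> 0"
proof
  assume ker: "img_sq m n A h = 0"
  define s where "s = (\<Sum>i\<in>I. \<bar>c i\<bar>)"
  have "s \<ge> 0" unfolding s_def by (intro sum_nonneg) simp
  moreover have "s \<noteq> 0"
  proof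
    assume "s = 0"
    then have "c i = 0" if "i \<in> I" for i
      using that I unfolding s_def by (subst (asm) sum_nonneg_eq_0_iff) auto
    then have "norm_sq n h = norm_sq n (\<lambda>_. 0)" by (intro norm_sq_cong) (simp add: h)
    with h0 show False by (simp add: norm_sq_def)
  qed
  ultimately have s: "s > 0" by simp
  define p where "p i = \<bar>c i\<bar> / s" for i
  \<comment> \<open>Signs are moved into the atoms, so that the weights p form a probability
    distribution.\<close>
  define e where "e i = (if c i < 0 then -1 else 1 :: real)" for i
  define \<xi> where "\<xi> i j = e i * \<psi> i j" for i j
  define \<mu> where "\<mu> j = (\<Sum>i\<in>I. p i * \<xi> i j)" for j
  define q where "q x = img_sq m n A x - real m / 8 * norm_sq n x" for x
  have p: "(\<Sum>i\<in>I. p i) = 1" using s by (simp add: p_def s_def sum_divide_distrib[symmetric])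
  have p0: "p i \<ge> 0" for i using s by (simp add: p_def)
  have \<mu>h: "\<mu> j = (1 / s) * h j" if "j < n" for j
  proof -
    have "p i * \<xi> i j = (1 / s) * (c i * \<psi> i j)" for i by (simp add: p_def \<xi>_def e_def)
    then show ?thesis by (simp add: \<mu>_def h[OF that] sum_distrib_left)
  qed
  have img\<mu>: "img_sq m n A \<mu> = 0"
  proof -
    have "img_sq m n A \<mu> = img_sq m n A (\<lambda>j. (1 / s) * h j)" by (rule img_sq_cong, rule \<mu>h)
    then show ?thesis by (simp only: img_sq_scale ker mult_zero_right)
  qed
  define w where "w = norm_sq n h / s\<^sup>2"
  have norm\<mu>: "norm_sq n \<mu> = w"
  proof -
    have "norm_sq n \<mu> = norm_sq n (\<lambda>j. (1 / s) * h j)" by (rule norm_sq_cong, rule \<mu>h)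
    then show ?thesis by (simp only: norm_sq_scale power_one_over) (simp add: w_def)
  qed
  have qsum: "(\<Sum>i\<in>I. p i * q (f i)) = (\<Sum>i\<in>I. p i * img_sq m n A (f i))
      - real m / 8 * (\<Sum>i\<in>I. p i * norm_sq n (f i))" for f
    unfolding q_def sum_distrib_left sum_subtractf[symmetric] by (simp add: algebra_simps)
  have avg: "(\<Sum>i\<in>I. p i * q (\<lambda>j. y j + \<xi> i j)) = q (\<lambda>j. y j + \<mu> j) + ((\<Sum>i\<in>I. p i * q (\<xi> i)) - q \<mu>)" for y
    unfolding qsum norm_sq_average[where \<mu>=\<mu> and \<xi>=\<xi>, OF p \<mu>_def]
      img_sq_average[where \<mu>=\<mu> and \<xi>=\<xi>, OF p \<mu>_def]
    unfolding q_def by (simp add: algebra_simps)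
  obtain is' where is': "length is' = k" "set is' \<subseteq> I"
    "q (\<lambda>j. \<Sum>i\<leftarrow>is'. \<xi> i j) \<le> q (\<lambda>j. real k * \<mu> j) + real k * ((\<Sum>i\<in>I. p i * q (\<xi> i)) - q \<mu>)"
    using maurey_choice[where y="\<lambda>_. 0" and k=k, OF I p0 p avg] by auto
  have "(\<lambda>j. \<Sum>i\<leftarrow>is'. \<xi> i j) = signed_combination \<psi> (map (\<lambda>i. (i, e i)) is')"
    by (auto simp: signed_combination_def fun_eq_iff \<xi>_def comp_def)
  moreover have "q (signed_combination \<psi> (map (\<lambda>i. (i, e i)) is')) \<ge> 0"
  proof -
    have "set (map (\<lambda>i. (i, e i)) is') \<subseteq> I \<times> {-1, 1}" using is'(2) by (auto simp: e_def)
    from lower[OF _ this] show ?thesis using is'(1) by (simp add: q_def)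
  qed
  ultimately have "0 \<le> q (\<lambda>j. real k * \<mu> j) + real k * ((\<Sum>i\<in>I. p i * q (\<xi> i)) - q \<mu>)"
    using is'(3) by simp
  also have "q (\<lambda>j. real k * \<mu> j) = (real k)\<^sup>2 * q \<mu>"
    by (simp add: q_def norm_sq_scale img_sq_scale algebra_simps)
  also have "q \<mu> = - (real m / 8 * w)"
    by (simp add: q_def img\<mu> norm\<mu>)
  also have "(\<Sum>i\<in>I. p i * q (\<xi> i)) \<le> (\<Sum>i\<in>I. p i * (4 * real m))"
  proof (intro sum_mono mult_left_mono p0)
    fix i assume "i \<in> I"
    have "img_sq m n A (\<xi> i) = img_sq m n A (\<psi> i)"
      unfolding \<xi>_def[abs_def] img_sq_scale by (simp add: e_def)
    then show "q (\<xi> i) \<le> 4 * real m"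
      using upper[OF \<open>i \<in> I\<close>] mult_nonneg_nonneg[OF _ norm_sq_nonneg[of n "\<xi> i"], of "real m / 8"]
      unfolding q_def by simp
  qed
  also have "\<dots> = 4 * real m" using p by (simp add: sum_distrib_right[symmetric])
  finally have "0 \<le> (real k)\<^sup>2 * - (real m / 8 * w)
      + real k * (4 * real m - - (real m / 8 * w))"
    by (simp add: mult_left_mono)
  also have "\<dots> = (real k * real m / 8) * (32 - (real k - 1) * w)"
    by (simp add: power2_eq_square algebra_simps)
  finally have "0 \<le> (real k * real m / 8) * (32 - (real k - 1) * w)" .
  moreover have "0 < real k * real m / 8" using k(2) \<open>0 < m\<close> by simp
  ultimately have "0 \<le> 32 - (real k - 1) * w" by (metis mult_pos_neg not_le)
  then have "(real k - 1) * w \<le> 32" by simp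
  then have "(real k - 1) * norm_sq n h \<le> 32 * s\<^sup>2" using s by (simp add: w_def field_simps)
  also have "\<dots> \<le> (32 * R) * norm_sq n h" using c by (simp add: s_def)
  finally show False using k(1) h0 by (simp add: mult_le_cancel_right)
qed

section \<open>Union bound over signed sums of atoms\<close>

lemma signed_atoms_good_probability:
  fixes \<psi> :: "nat \<Rightarrow> nat \<Rightarrow> real"
  assumes "0 < m" and unit: "\<And>i. i < n \<Longrightarrow> norm_sq n (\<psi> i) = 1"
    and m: "u\<^sup>2 + 2 * (real k + 1) * ln (2 * real n) \<le> real m" and n: "n > 0" and k: "k > 0"
    and G: "G \<in> sets (gaussian_matrix m n)"
    and sub: "\<And>A. A \<in> space (gaussian_matrix m n) \<Longrightarrow>
      (\<And>ps. length ps = k \<Longrightarrow> set ps \<subseteq> {..<n} \<times> {-1, 1} \<Longrightarrow>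
         img_sq m n A (signed_combination \<psi> ps) \<ge> real m / 8 * norm_sq n (signed_combination \<psi> ps)) \<Longrightarrow>
      (\<And>i. i < n \<Longrightarrow> img_sq m n A (\<psi> i) \<le> 4 * real m) \<Longrightarrow> A \<in> G"
  shows "measure (gaussian_matrix m n) G \<ge> 1 - exp (- u\<^sup>2 / 2)"
proof -
  interpret P: prob_space "gaussian_matrix m n" by (rule prob_space_gaussian_matrix)
  let ?M = "gaussian_matrix m n"
  \<comment> \<open>Lists instead of sets, since Maurey's choice may draw the same atom
    repeatedly.\<close>
  define L where "L = {ps. set ps \<subseteq> {..<n} \<times> {-1, 1::real} \<and> length ps = k}"
  have finL: "finite L" unfolding L_def by (intro finite_lists_length_eq) auto
  have cardL: "card L = (2 * n) ^ k"
  proof -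
    have "card ({..<n} \<times> {-1, 1::real}) = 2 * n" by (simp add: card_cartesian_product)
    then show ?thesis unfolding L_def by (subst card_lists_length_eq) (simp, simp only:)
  qed
  define E1 where "E1 ps = {A \<in> space ?M. img_sq m n A (signed_combination \<psi> ps)
     < real m / 8 * norm_sq n (signed_combination \<psi> ps)}" for ps
  define E2 where "E2 i = {A \<in> space ?M. img_sq m n A (\<psi> i) > 4 * real m}" for i
  have meas: "E1 ps \<in> sets ?M" "E2 i \<in> sets ?M" for ps i
    unfolding E1_def E2_def by measurable
  have E1: "P.prob (E1 ps) \<le> exp (- real m / 2)" for ps
  \<comment> \<open>Signed atoms may cancel to the zero vector, which cannot be normalised; the
    strict inequality then makes the bad event empty.\<close>
  proof (cases "norm_sq n (signed_combination \<psi> ps) = 0")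
    case True
    then have "E1 ps = {}"
      using norm_sq_nonneg[of m] by (auto simp: E1_def img_sq_conv_norm_sq not_less)
    then show ?thesis by simp
  next
    case False
    define N where "N = norm_sq n (signed_combination \<psi> ps)"
    have N: "N > 0" using False norm_sq_nonneg[of n "signed_combination \<psi> ps"] by (simp add: N_def)
    define x where "x j = (1 / sqrt N) * signed_combination \<psi> ps j" for j
    have x1: "norm_sq n x = 1"
      using N unfolding x_def[abs_def] norm_sq_scale by (simp add: N_def power_one_over)
    have "img_sq m n A x = img_sq m n A (signed_combination \<psi> ps) / N" for A
      using N unfolding x_def[abs_def] img_sq_scale by (simp add: power_one_over)
    then have "E1 ps \<subseteq> {A \<in> space ?M. img_sq m n A x \<le> m / 8}"
      using N by (auto simp: E1_def N_def[symmetric] pos_divide_le_eq)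
    then have "P.prob (E1 ps) \<le> P.prob {A \<in> space ?M. img_sq m n A x \<le> m / 8}"
      by (intro P.finite_measure_mono) auto
    also have "\<dots> \<le> exp (- real m / 2)" by (rule img_sq_lower_tail[OF \<open>0 < m\<close> x1])
    finally show ?thesis .
  qed
  have E2: "P.prob (E2 i) \<le> exp (- real m / 2)" if "i < n" for i
  proof -
    have "P.prob (E2 i) \<le> P.prob {A \<in> space ?M. img_sq m n A (\<psi> i) \<ge> 4 * m}"
      by (intro P.finite_measure_mono) (auto simp: E2_def)
    also have "\<dots> \<le> exp (- real m / 2)" by (rule img_sq_upper_tail[OF \<open>0 < m\<close> unit[OF that]])
    finally show ?thesis .
  qed
  define B where "B = (\<Union>ps\<in>L. E1 ps) \<union> (\<Union>i<n. E2 i)"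
  have Bm: "B \<in> sets ?M" unfolding B_def using finL meas by (intro sets.Un sets.finite_UN) auto
  have "P.prob B \<le> P.prob (\<Union>ps\<in>L. E1 ps) + P.prob (\<Union>i<n. E2 i)"
    unfolding B_def using finL meas by (intro measure_Un_le sets.finite_UN) auto
  also have "P.prob (\<Union>ps\<in>L. E1 ps) \<le> (\<Sum>ps\<in>L. P.prob (E1 ps))"
    using finL meas by (intro measure_UNION_le) auto
  also have "\<dots> \<le> (\<Sum>ps\<in>L. exp (- real m / 2))" by (intro sum_mono E1)
  also have "P.prob (\<Union>i<n. E2 i) \<le> (\<Sum>i<n. P.prob (E2 i))"
    using meas by (intro measure_UNION_le) auto
  also have "\<dots> \<le> (\<Sum>i<n. exp (- real m / 2))" by (intro sum_mono E2) auto
  finally have "P.prob B \<le> ((2 * real n) ^ k + real n) * exp (- real m / 2)"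
    by (simp add: cardL distrib_right)
  \<comment> \<open>The n events of the second kind are absorbed by one more factor 2 n, whence k +
    1 in the hypothesis on m.\<close>
  also have "\<dots> \<le> (2 * real n) ^ (k + 1) * exp (- real m / 2)"
  proof (intro mult_right_mono)
    have "(2 * real n) ^ 1 \<le> (2 * real n) ^ k" using n k by (intro power_increasing) auto
    then have "2 * real n \<le> (2 * real n) ^ k" by (simp only: power_one_right)
    then have "(2 * real n) ^ k + real n \<le> 2 * (2 * real n) ^ k" by linarith
    also have "\<dots> \<le> (2 * real n) * (2 * real n) ^ k" using n by (intro mult_right_mono) auto
    finally show "(2 * real n) ^ k + real n \<le> (2 * real n) ^ (k + 1)" by simp
  qed simp
  also have "(2 * real n) ^ (k + 1) = exp ((real k + 1) * ln (2 * real n))"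
    using n exp_of_nat_mult[of "k + 1" "ln (2 * real n)"] by (simp add: add.commute)
  also have "\<dots> * exp (- real m / 2) \<le> exp (- u\<^sup>2 / 2)"
    using m by (simp add: exp_add[symmetric] algebra_simps)
  finally have "P.prob B \<le> exp (- u\<^sup>2 / 2)" .
  moreover have "P.prob (space ?M - B) \<le> P.prob G"
  proof (intro P.finite_measure_mono G subsetI)
    fix A assume A: "A \<in> space ?M - B"
    show "A \<in> G"
    proof (rule sub)
      show "A \<in> space ?M" using A by simp
      show "img_sq m n A (signed_combination \<psi> ps) \<ge> real m / 8 * norm_sq n (signed_combination \<psi> ps)"
        if "length ps = k" "set ps \<subseteq> {..<n} \<times> {-1, 1}" for ps
        using A that by (auto simp: B_def L_def E1_def not_less)
      show "img_sq m n A (\<psi> i) \<le> 4 * real m" if "i < n" for i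
        using A that by (auto simp: B_def E2_def not_less)
    qed
  qed
  ultimately show ?thesis using P.prob_compl[OF Bm] by simp
qed

section \<open>Measurability of the recovery event\<close>

lemma matvec_eq_iff_img_sq:
  "matvec m n A x = matvec m n A y \<longleftrightarrow> img_sq m n A (\<lambda>j. x j - y j) = 0"
proof -
  have "img_sq m n A (\<lambda>j. x j - y j) = 0 \<longleftrightarrow> (\<forall>r<m. (\<Sum>j<n. A (r, j) * (x j - y j)) = 0)"
    unfolding img_sq_def by (subst sum_nonneg_eq_0_iff) auto
  also have "\<dots> \<longleftrightarrow> (\<forall>r<m. (\<Sum>j<n. A (r, j) * x j) = (\<Sum>j<n. A (r, j) * y j))"
    by (simp add: right_diff_distrib sum_subtractf)
  finally show ?thesis
    unfolding matvec_def fun_eq_iff by auto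
qed

lemma continuous_coord: "continuous_on S (\<lambda>x::nat \<Rightarrow> real. x j)"
  by (rule continuous_on_subset[OF continuous_on_product_coordinates]) simp

text \<open>The topology is the product topology on all sequences, where free coordinates beyond n
  would destroy compactness; pinned to 0, they leave a closed subset of a Tychonoff box.\<close>

lemma compact_norm_ball: "compact {x::nat \<Rightarrow> real. norm_sq n (\<lambda>j. x j - y j) \<le> c \<and> (\<forall>j\<ge>n. x j = 0)}"
proof -
  define K where "K = {x::nat \<Rightarrow> real. norm_sq n (\<lambda>j. x j - y j) \<le> c \<and> (\<forall>j\<ge>n. x j = 0)}"
  \<comment> \<open>The radius |c| + 1 bounds each deviation without a square root of c, because |c|
    \<le> (|c| + 1)^2.\<close>
  define B where "B = PiE UNIV (\<lambda>j. if j < n then {y j - (\<bar>c\<bar> + 1)..y j + (\<bar>c\<bar> + 1)} else {0::real})"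
  have "compactin (product_topology (\<lambda>_. euclidean) UNIV) B"
    unfolding B_def compactin_PiE by (auto simp: compactin_euclidean_iff)
  then have "compact B" by (simp add: euclidean_product_topology compactin_euclidean_iff)
  moreover have "closed K"
  proof -
    have "K = {x. norm_sq n (\<lambda>j. x j - y j) \<le> c} \<inter> (\<Inter>j\<in>{n..}. {x. x j = 0})" by (auto simp: K_def)
    moreover have "closed {x. norm_sq n (\<lambda>j. x j - y j) \<le> c}"
      unfolding norm_sq_def by (intro closed_Collect_le continuous_intros continuous_coord)
    moreover have "closed {x::nat \<Rightarrow> real. x j = 0}" for j
      by (intro closed_Collect_eq continuous_intros continuous_coord)
    ultimately show ?thesis by auto
  qed
  moreover have "K \<subseteq> B"
  proof
    fix x assume x: "x \<in> K"
    have "\<bar>x j - y j\<bar> \<le> \<bar>c\<bar> + 1" if "j < n" for j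
    proof -
      have "(x j - y j)\<^sup>2 \<le> norm_sq n (\<lambda>j. x j - y j)"
        unfolding norm_sq_def using that by (intro member_le_sum) auto
      also have "\<dots> \<le> \<bar>c\<bar>" using x by (auto simp: K_def)
      also have "\<dots> \<le> (\<bar>c\<bar> + 1)\<^sup>2" by (simp add: power2_eq_square algebra_simps)
      finally show ?thesis by (metis abs_le_square_iff abs_of_nonneg abs_ge_zero add_nonneg_nonneg zero_le_one)
    qed
    then show "x \<in> B" using x by (fastforce simp: B_def K_def abs_le_iff)
  qed
  ultimately have "compact (B \<inter> K)" by (intro compact_Int_closed)
  with \<open>K \<subseteq> B\<close> have "compact K" by (simp add: Int_absorb1)
  then show ?thesis by (simp add: K_def)
qed

text \<open>On a compact set a continuous nonnegative function has a zero iff its infimum is 0, and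
  a countable dense subset already computes the infimum. The event is thus a countable intersection
  of countable unions.\<close>

lemma measurable_meets_kernel:
  fixes K :: "(nat \<Rightarrow> real) set"
  assumes "compact K"
  shows "{A \<in> space (gaussian_matrix m n). \<exists>x\<in>K. img_sq m n A (\<lambda>j. x j - y j) = 0} \<in> sets (gaussian_matrix m n)"
proof -
  obtain D where D: "countable D" "D \<subseteq> K" "K \<subseteq> closure D"
    by (rule separable)
  let ?f = "\<lambda>A x. img_sq m n A (\<lambda>j. x j - y j)"
  have cont: "continuous_on S (?f A)" for A S
    unfolding img_sq_def by (intro continuous_intros continuous_coord)
  have "(\<exists>x\<in>K. ?f A x = 0) \<longleftrightarrow> (\<forall>l. \<exists>x\<in>D. ?f A x < 1 / real (Suc l))" (is "?L \<longleftrightarrow> ?R") for A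
  proof
    assume ?L
    then obtain x where x: "x \<in> K" "?f A x = 0" by auto
    show ?R
    proof
      fix l
      have "open {x. ?f A x < 1 / real (Suc l)}"
        by (intro open_Collect_less continuous_on_const cont)
      moreover have "x \<in> {x. ?f A x < 1 / real (Suc l)} \<inter> closure D" using x D by auto
      ultimately have "{x. ?f A x < 1 / real (Suc l)} \<inter> D \<noteq> {}"
        using open_Int_closure_eq_empty by blast
      then show "\<exists>x\<in>D. ?f A x < 1 / real (Suc l)" by auto
    qed
  next
    assume R: ?R
    then have "K \<noteq> {}" using D by (metis empty_iff subset_empty)
    from continuous_attains_inf[OF assms this cont[of K A]] obtain x where
      x: "x \<in> K" "\<And>y. y \<in> K \<Longrightarrow> ?f A x \<le> ?f A y" by auto
    have "?f A x \<le> 0"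
    proof (rule ccontr)
      assume "\<not> ?f A x \<le> 0"
      then obtain l where "inverse (real (Suc l)) < ?f A x"
        using reals_Archimedean[of "?f A x"] by auto
      moreover obtain z where "z \<in> D" "?f A z < 1 / real (Suc l)" using R by blast
      ultimately show False using x(2)[of z] D by (auto simp: inverse_eq_divide)
    qed
    moreover have "?f A x \<ge> 0" unfolding img_sq_def by (intro sum_nonneg) simp
    ultimately show ?L using x by (intro bexI[of _ x]) auto
  qed
  then have "{A \<in> space (gaussian_matrix m n). \<exists>x\<in>K. ?f A x = 0}
     = (\<Inter>l. \<Union>x\<in>D. {A \<in> space (gaussian_matrix m n). ?f A x < 1 / real (Suc l)})"
    by auto
  also have "\<dots> \<in> sets (gaussian_matrix m n)"
    using D(1) by (intro sets.countable_INT sets.countable_UN' predE) (auto simp: pred_def)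
  finally show ?thesis .
qed

lemma norm_sq_pos_iff: "norm_sq n x > 0 \<longleftrightarrow> (\<exists>j<n. x j \<noteq> 0)"
proof -
  have "norm_sq n x \<ge> 0" unfolding norm_sq_def by (intro sum_nonneg) simp
  moreover have "norm_sq n x = 0 \<longleftrightarrow> (\<forall>j<n. x j = 0)"
    unfolding norm_sq_def by (subst sum_nonneg_eq_0_iff) auto
  ultimately show ?thesis by (metis less_eq_real_def less_irrefl)
qed

text \<open>The competitors of \<open>xs\<close> are exhausted by countably many compact sets that stay away from
  \<open>xs\<close>; on each of them the existence of a kernel element is a countable condition.\<close>

lemma measurable_unique_tv_minimizer:
  "{A \<in> space (gaussian_matrix m n). unique_tv_minimizer m n A xs} \<in> sets (gaussian_matrix m n)"
proof -
  define K where "K k = {x::nat \<Rightarrow> real. norm_sq n (\<lambda>j. x j - xs j) \<le> real k \<and> (\<forall>j\<ge>n. x j = 0)}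
      \<inter> {x. tv_norm n x \<le> tv_norm n xs} \<inter> {x. 1 / real (Suc k) \<le> norm_sq n (\<lambda>j. x j - xs j)}" for k
  have "compact (K k)" for k
  proof -
    have "closed {x. tv_norm n x \<le> tv_norm n xs}"
      unfolding tv_norm_def by (intro closed_Collect_le continuous_intros continuous_coord)
    moreover have "closed {x. 1 / real (Suc k) \<le> norm_sq n (\<lambda>j. x j - xs j)}"
      unfolding norm_sq_def by (intro closed_Collect_le continuous_intros continuous_coord)
    ultimately show ?thesis
      unfolding K_def by (intro compact_Int_closed compact_norm_ball)
  qed
  note meas = measurable_meets_kernel[OF this, of m n _ xs]
  have "\<not> unique_tv_minimizer m n A xs \<longleftrightarrow> (\<exists>k. \<exists>x\<in>K k. img_sq m n A (\<lambda>j. x j - xs j) = 0)" (is "?L \<longleftrightarrow> ?R") for A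
  proof
    assume ?L
    then obtain x' where x': "matvec m n A x' = matvec m n A xs" "\<exists>j<n. x' j \<noteq> xs j" "tv_norm n x' \<le> tv_norm n xs"
      unfolding unique_tv_minimizer_def by (auto simp: not_less)
    \<comment> \<open>Cutting the competitor off at n changes none of the three quantities and
      places it in the compact sets.\<close>
    define x where "x j = (if j < n then x' j else 0)" for j
    have eqs: "img_sq m n A (\<lambda>j. x j - xs j) = img_sq m n A (\<lambda>j. x' j - xs j)"
      "norm_sq n (\<lambda>j. x j - xs j) = norm_sq n (\<lambda>j. x' j - xs j)" "tv_norm n x = tv_norm n x'"
      by (auto simp: img_sq_def norm_sq_def tv_norm_def x_def intro!: sum.cong)
    have pos: "norm_sq n (\<lambda>j. x j - xs j) > 0" using x'(2) eqs(2) by (simp add: norm_sq_pos_iff)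
    obtain k1 where k1: "norm_sq n (\<lambda>j. x j - xs j) \<le> real k1" by (metis real_arch_simple)
    obtain k2 where k2: "inverse (real (Suc k2)) < norm_sq n (\<lambda>j. x j - xs j)"
      using reals_Archimedean[OF pos] by auto
    have "1 / real (Suc (max k1 k2)) \<le> inverse (real (Suc k2))" by (simp add: field_simps)
    then have "x \<in> K (max k1 k2)"
      using k1 k2 x' eqs by (auto simp: K_def x_def)
    moreover have "img_sq m n A (\<lambda>j. x j - xs j) = 0"
      using x'(1) eqs(1) by (simp add: matvec_eq_iff_img_sq)
    ultimately show ?R by blast
  next
    assume ?R
    then obtain k x where kx: "x \<in> K k" "img_sq m n A (\<lambda>j. x j - xs j) = 0" by blast
    then have "0 < 1 / real (Suc k)" "1 / real (Suc k) \<le> norm_sq n (\<lambda>j. x j - xs j)" by (auto simp: K_def)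
    then have "norm_sq n (\<lambda>j. x j - xs j) > 0" by linarith
    then have "\<exists>j<n. x j \<noteq> xs j" by (simp add: norm_sq_pos_iff)
    moreover have "matvec m n A x = matvec m n A xs" using kx(2) by (simp add: matvec_eq_iff_img_sq)
    moreover have "tv_norm n x \<le> tv_norm n xs" using kx(1) by (simp add: K_def)
    ultimately show ?L unfolding unique_tv_minimizer_def by force
  qed
  then have "{A \<in> space (gaussian_matrix m n). unique_tv_minimizer m n A xs}
    = space (gaussian_matrix m n) - (\<Union>k. {A \<in> space (gaussian_matrix m n). \<exists>x\<in>K k. img_sq m n A (\<lambda>j. x j - xs j) = 0})"
    by auto
  also have "\<dots> \<in> sets (gaussian_matrix m n)"
    using meas by (intro sets.compl_sets sets.countable_UN) auto
  finally show ?thesis .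
qed

section \<open>Decomposition into indicator functions of intervals\<close>

definition next_point :: "nat set \<Rightarrow> nat \<Rightarrow> nat" where
  "next_point Q i = Min {q \<in> Q. i < q}"

text \<open>Abel summation within a block: its value at the left end, carried by the whole block,
  plus increments, each carried by the rest of the block. This gives one atom per index, hence only
  n atoms for the union bound.\<close>

definition step_coeff :: "nat set \<Rightarrow> (nat \<Rightarrow> real) \<Rightarrow> nat \<Rightarrow> real" where
  "step_coeff Q h i = (if i \<in> Q then h i else h i - h (i - 1))"

definition step_fun :: "nat set \<Rightarrow> nat \<Rightarrow> nat \<Rightarrow> real" where
  "step_fun Q i j = (if i \<le> j \<and> j < next_point Q i then 1 else 0)"

lemma abs_diff_le_variation:
  fixes h :: "nat \<Rightarrow> real"
  assumes "p \<le> j"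
  shows "\<bar>h j - h p\<bar> \<le> (\<Sum>i\<in>{p<..j}. \<bar>h i - h (i - 1)\<bar>)"
  using sum_abs[of "\<lambda>i. h i - h (i - 1)" "{p<..j}"] sum_telescope''[OF assms, of h]
  by (simp only: atLeastSucAtMost_greaterThanAtMost)

lemma abs_mult_sqrt_card_le:
  fixes f :: "'i \<Rightarrow> real"
  assumes "\<And>i. i \<in> I \<Longrightarrow> \<bar>c\<bar> \<le> \<bar>f i\<bar>"
  shows "\<bar>c\<bar> * sqrt (real (card I)) \<le> sqrt (\<Sum>i\<in>I. (f i)\<^sup>2)"
proof -
  have "real (card I) * c\<^sup>2 \<le> (\<Sum>i\<in>I. (f i)\<^sup>2)"
    by (rule sum_bounded_below) (rule abs_le_square_iff[THEN iffD1, OF assms])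
  from real_sqrt_le_mono[OF this] show ?thesis
    by (simp only: real_sqrt_mult real_sqrt_abs mult.commute)
qed

text \<open>The value at the left end may be a spike that the l2-norm of the block hardly sees. The
  smallest |h j| in the block is controlled by that norm, and passing from j to p costs at most the
  variation inside the block.\<close>

lemma block_bound:
  fixes h :: "nat \<Rightarrow> real"
  assumes pl: "p < l"
  shows "\<bar>h p\<bar> * sqrt (real (l - p))
    \<le> sqrt (\<Sum>j\<in>{p..<l}. (h j)\<^sup>2) + (\<Sum>i\<in>{p<..<l}. sqrt (real (l - p)) * \<bar>h i - h (i - 1)\<bar>)"
proof -
  have block: "finite {p..<l}" "{p..<l} \<noteq> {}" using pl by simp_all
  obtain j where j: "p \<le> j" "j < l" "\<And>i. i \<in> {p..<l} \<Longrightarrow> \<bar>h j\<bar> \<le> \<bar>h i\<bar>"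
    using arg_min_if_finite(1)[OF block] arg_min_least[OF block, of _ "\<lambda>j. \<bar>h j\<bar>"]
    by (metis atLeastLessThan_iff)
  have "\<bar>h j - h p\<bar> \<le> (\<Sum>i\<in>{p<..<l}. \<bar>h i - h (i - 1)\<bar>)"
    by (rule order_trans[OF abs_diff_le_variation[OF j(1)] sum_mono2]) (use j(2) in auto)
  then have "\<bar>h p\<bar> \<le> \<bar>h j\<bar> + (\<Sum>i\<in>{p<..<l}. \<bar>h i - h (i - 1)\<bar>)" by linarith
  then have "\<bar>h p\<bar> * sqrt (real (l - p))
     \<le> (\<bar>h j\<bar> + (\<Sum>i\<in>{p<..<l}. \<bar>h i - h (i - 1)\<bar>)) * sqrt (real (l - p))"
    by (rule mult_right_mono[OF _ real_sqrt_ge_zero[OF of_nat_0_le_iff]])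
  also have "\<dots> = \<bar>h j\<bar> * sqrt (real (l - p)) + (\<Sum>i\<in>{p<..<l}. sqrt (real (l - p)) * \<bar>h i - h (i - 1)\<bar>)"
    unfolding distrib_right sum_distrib_left[symmetric] by (simp only: mult.commute)
  also have "\<dots> \<le> sqrt (\<Sum>j\<in>{p..<l}. (h j)\<^sup>2) + (\<Sum>i\<in>{p<..<l}. sqrt (real (l - p)) * \<bar>h i - h (i - 1)\<bar>)"
    using abs_mult_sqrt_card_le[of "{p..<l}" "h j" h, OF j(3)] by (simp only: card_atLeastLessThan add_le_cancel_right)
  finally show ?thesis .
qed

locale partition_points =
  fixes n :: nat and Q :: "nat set"
  assumes n_in: "n \<in> Q" and zero_in: "0 \<in> Q" and Q_le: "Q \<subseteq> {..n}"
begin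

lemma finite_Q: "finite Q"
  using Q_le finite_subset by blast

lemma next_point:
  assumes "i < n"
  shows "next_point Q i \<in> Q" "i < next_point Q i" "next_point Q i \<le> n"
proof -
  have "{q \<in> Q. i < q} \<noteq> {}" "finite {q \<in> Q. i < q}" using n_in assms finite_Q by auto
  from Min_in[OF this(2,1)] show "next_point Q i \<in> Q" "i < next_point Q i" "next_point Q i \<le> n"
    using Q_le by (auto simp: next_point_def)
qed

lemma next_point_le: "q \<in> Q \<Longrightarrow> i < q \<Longrightarrow> next_point Q i \<le> q"
  unfolding next_point_def using finite_Q by (intro Min_le) auto

lemma ex_previous_point:
  assumes "i < n" "i \<notin> Q"
  obtains p where "p \<in> Q" "p < i" "i < next_point Q p" "next_point Q i = next_point Q p"
proof -
  let ?P = "{q \<in> Q. q < i}"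
  have "0 \<in> ?P" using zero_in assms by (cases "i = 0") auto
  then have ne: "?P \<noteq> {}" "finite ?P" using finite_Q by auto
  define p where "p = Max ?P"
  have p: "p \<in> Q" "p < i" using Max_in[OF ne(2,1)] by (auto simp: p_def)
  have pmax: "q \<le> p" if "q \<in> Q" "q < i" for q using that ne by (auto simp: p_def)
  have "p < n" using p assms by simp
  note np = next_point[OF this]
  have "i < next_point Q p"
    using pmax[OF np(1)] np(2) np(1) assms(2) by (metis not_le linorder_neqE_nat)
  moreover have "next_point Q i = next_point Q p"
    using next_point_le[of "next_point Q i" p] next_point[OF assms(1)] p calculation
      next_point_le[OF np(1), of i] by (intro antisym) auto
  ultimately show ?thesis using p that by blast
qed

text \<open>Passing from j - 1 to j outside Q only switches on the atom starting at j, as no atom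
  ends there. At j in Q all earlier atoms have ended and the sum restarts with h j.\<close>

lemma step_decomposition:
  assumes "j < n"
  shows "h j = (\<Sum>i<n. step_coeff Q h i * step_fun Q i j)"
  using assms
proof (induction j rule: less_induct)
  case (less j)
  show ?case
  proof (cases "j \<in> Q")
    case True
    have "step_fun Q i j = (if i = j then 1 else 0)" for i
      using next_point_le[OF True, of i] next_point[OF less.prems]
      by (cases "i < j") (auto simp: step_fun_def)
    then show ?thesis using less.prems True
      by (simp add: step_coeff_def if_distrib[of "\<lambda>x. _ * x"] sum.delta cong: if_cong)
  next
    case False
    then have "j > 0" using zero_in by (cases j) auto
    have "step_fun Q i j = step_fun Q i (j - 1) + (if i = j then 1 else 0)" if "i < n" for i
    proof -
      have "next_point Q i \<noteq> j" using next_point[OF that] False by auto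
      then show ?thesis using \<open>j > 0\<close> next_point(2)[OF that] by (auto simp: step_fun_def)
    qed
    then have "(\<Sum>i<n. step_coeff Q h i * step_fun Q i j)
      = (\<Sum>i<n. step_coeff Q h i * step_fun Q i (j - 1)) + (\<Sum>i<n. step_coeff Q h i * (if i = j then 1 else 0))"
      by (simp add: distrib_left sum.distrib)
    also have "(\<Sum>i<n. step_coeff Q h i * step_fun Q i (j - 1)) = h (j - 1)"
      using less \<open>j > 0\<close> by simp
    also have "(\<Sum>i<n. step_coeff Q h i * (if i = j then 1 else 0)) = h j - h (j - 1)"
      using less.prems False by (simp add: step_coeff_def if_distrib[of "\<lambda>x. _ * x"] sum.delta cong: if_cong)
    finally show ?thesis by simp
  qed
qed

lemma norm_sq_step_fun:
  assumes "i < n"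
  shows "norm_sq n (step_fun Q i) = real (next_point Q i - i)"
proof -
  have "norm_sq n (step_fun Q i) = (\<Sum>j\<in>{i..<next_point Q i}. 1)"
    unfolding norm_sq_def using next_point[OF assms]
    by (intro sum.mono_neutral_cong_right) (auto simp: step_fun_def)
  then show ?thesis by simp
qed

lemma blocks_disjoint:
  assumes "p \<in> Q" "p' \<in> Q" "p \<noteq> p'"
  shows "{p..<next_point Q p} \<inter> {p'..<next_point Q p'} = {}"
  using next_point_le[OF assms(2), of p] next_point_le[OF assms(1), of p'] assms(3)
  by (meson disjoint_iff atLeastLessThan_iff linorder_neqE_nat not_le order_trans)

text \<open>Cauchy-Schwarz over the disjoint blocks; this is how the number of partition points
  enters R.\<close>

lemma sum_block_norms:
  "(\<Sum>p\<in>Q \<inter> {..<n}. sqrt (\<Sum>j\<in>{p..<next_point Q p}. (h j)\<^sup>2)) \<le> sqrt (real (card Q)) * sqrt (norm_sq n h)"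
proof (rule order_trans[OF real_le_rsqrt])
  let ?B = "\<lambda>p. {p..<next_point Q p}" and ?Q = "Q \<inter> {..<n}"
  have "(\<Sum>p\<in>?Q. sqrt (\<Sum>j\<in>?B p. (h j)\<^sup>2))\<^sup>2 \<le> real (card ?Q) * (\<Sum>p\<in>?Q. \<Sum>j\<in>?B p. (h j)\<^sup>2)"
    using Cauchy_Schwarz_ineq_sum[of "\<lambda>_. 1" "\<lambda>p. sqrt (\<Sum>j\<in>?B p. (h j)\<^sup>2)" ?Q] by (simp add: sum_nonneg)
  also have "(\<Sum>p\<in>?Q. \<Sum>j\<in>?B p. (h j)\<^sup>2) = (\<Sum>j\<in>\<Union>(?B ` ?Q). (h j)\<^sup>2)"
    using blocks_disjoint by (intro sum.UNION_disjoint[symmetric]) auto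
  also have "\<dots> \<le> norm_sq n h"
    unfolding norm_sq_def using next_point(3) by (intro sum_mono2) (auto, metis less_le_trans)
  finally show "(\<Sum>p\<in>?Q. sqrt (\<Sum>j\<in>?B p. (h j)\<^sup>2))\<^sup>2 \<le> real (card ?Q) * norm_sq n h"
    by (simp add: mult_left_mono)
  show "sqrt (real (card ?Q) * norm_sq n h) \<le> sqrt (real (card Q)) * sqrt (norm_sq n h)"
    unfolding real_sqrt_mult using finite_Q norm_sq_nonneg by (simp add: card_mono mult_right_mono)
qed

lemma Union_open_blocks: "(\<Union>p\<in>Q \<inter> {..<n}. {p<..<next_point Q p}) = {1..<n} - Q"
proof (rule set_eqI, rule iffI)
  fix i assume "i \<in> (\<Union>p\<in>Q \<inter> {..<n}. {p<..<next_point Q p})"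
  then obtain p where "p \<in> Q \<inter> {..<n}" "i \<in> {p<..<next_point Q p}" by (rule UN_E)
  then have p: "p < n" "p < i" "i < next_point Q p" by simp_all
  have "i \<notin> Q"
  proof
    assume "i \<in> Q"
    from next_point_le[OF this p(2)] p(3) show False by (rule leD[THEN notE])
  qed
  moreover have "i < n" using p(3) next_point(3)[OF p(1)] by (rule less_le_trans)
  ultimately show "i \<in> {1..<n} - Q" using p(2) by simp
next
  fix i assume i: "i \<in> {1..<n} - Q"
  then have "i < n" "i \<notin> Q" by simp_all
  then obtain p where "p \<in> Q" "p < i" "i < next_point Q p" by (rule ex_previous_point)
  moreover from \<open>p < i\<close> \<open>i < n\<close> have "p < n" by (rule less_trans)
  ultimately have "p \<in> Q \<inter> {..<n}" "i \<in> {p<..<next_point Q p}" by simp_all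
  then show "i \<in> (\<Union>p\<in>Q \<inter> {..<n}. {p<..<next_point Q p})" by (rule UN_I)
qed

lemma sum_open_blocks:
  fixes f :: "nat \<Rightarrow> real"
  shows "(\<Sum>p\<in>Q \<inter> {..<n}. \<Sum>i\<in>{p<..<next_point Q p}. f i) = (\<Sum>i\<in>{1..<n} - Q. f i)"
  unfolding Union_open_blocks[symmetric]
  using blocks_disjoint by (intro sum.UNION_disjoint[symmetric]) fastforce+

text \<open>The left side is the l1-norm of the coefficients with respect to normalised atoms. The
  factor 2 arises because an increment is charged twice: for its own atom, and through
  \<open>block_bound\<close> for the left end of its block.\<close>

lemma step_coeff_bound:
  assumes W: "\<And>p i. p \<in> Q \<Longrightarrow> p < n \<Longrightarrow> p < i \<Longrightarrow> i < next_point Q p \<Longrightarrow> sqrt (real (next_point Q p - p)) \<le> W i"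
  shows "(\<Sum>i<n. \<bar>step_coeff Q h i\<bar> * sqrt (real (next_point Q i - i)))
    \<le> sqrt (real (card Q)) * sqrt (norm_sq n h) + 2 * (\<Sum>i\<in>{1..<n} - Q. W i * \<bar>h i - h (i - 1)\<bar>)"
proof -
  let ?g = "\<lambda>i. \<bar>h i - h (i - 1)\<bar>" and ?N = "next_point Q" and ?Q = "Q \<inter> {..<n}"
  have split: "{..<n} = ?Q \<union> ({1..<n} - Q)" using zero_in by (auto simp: Suc_le_eq intro: gr0I)
  have "(\<Sum>i<n. \<bar>step_coeff Q h i\<bar> * sqrt (real (?N i - i)))
    = (\<Sum>p\<in>?Q. \<bar>h p\<bar> * sqrt (real (?N p - p))) + (\<Sum>i\<in>{1..<n} - Q. ?g i * sqrt (real (?N i - i)))"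
    by (subst split, subst sum.union_disjoint) (auto simp: step_coeff_def)
  also have "(\<Sum>i\<in>{1..<n} - Q. ?g i * sqrt (real (?N i - i))) \<le> (\<Sum>i\<in>{1..<n} - Q. W i * ?g i)"
  proof (rule sum_mono)
    fix i assume i: "i \<in> {1..<n} - Q"
    then obtain p where p: "p \<in> Q" "p < i" "i < ?N p" "?N i = ?N p"
      using ex_previous_point[of i] by auto
    then have "sqrt (real (?N i - i)) \<le> sqrt (real (?N p - p))" by simp
    also have "\<dots> \<le> W i" using p i by (intro W) auto
    finally show "?g i * sqrt (real (?N i - i)) \<le> W i * ?g i"
      by (subst mult.commute) (intro mult_right_mono abs_ge_zero)
  qed
  also have "(\<Sum>p\<in>?Q. \<bar>h p\<bar> * sqrt (real (?N p - p)))
    \<le> (\<Sum>p\<in>?Q. sqrt (\<Sum>j\<in>{p..<?N p}. (h j)\<^sup>2) + (\<Sum>i\<in>{p<..<?N p}. W i * ?g i))"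
  proof (rule sum_mono)
    fix p assume "p \<in> ?Q"
    then have "p \<in> Q" "p < n" by simp_all
    then show "\<bar>h p\<bar> * sqrt (real (?N p - p))
       \<le> sqrt (\<Sum>j\<in>{p..<?N p}. (h j)\<^sup>2) + (\<Sum>i\<in>{p<..<?N p}. W i * ?g i)"
      by (intro order_trans[OF block_bound] next_point add_left_mono sum_mono mult_right_mono W) auto
  qed
  also have "\<dots> = (\<Sum>p\<in>?Q. sqrt (\<Sum>j\<in>{p..<?N p}. (h j)\<^sup>2)) + (\<Sum>i\<in>{1..<n} - Q. W i * ?g i)"
    by (simp only: sum.distrib sum_open_blocks)
  finally show ?thesis using sum_block_norms[of h] by linarith
qed

end

section \<open>The dual profile of a jump set\<close>

lemma harm_le_ln:
  assumes "n > 0"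
  shows "(\<Sum>t<n. 1 / real (Suc t)) \<le> 1 + ln (real n)"
proof -
  obtain k where k: "n = Suc k" using assms gr0_implies_Suc by blast
  have "harm (Suc k) - ln (real (Suc k)) \<le> harm (Suc 0) - ln (real (Suc 0))"
    using decseq_harm_diff_ln decseqD by fastforce
  then show ?thesis by (simp add: k harm_altdef inverse_eq_divide)
qed

text \<open>The square root is essential: a linear profile has smaller energy, but its weight
  \<open>\<bar>t\<bar> / L\<close> next to a jump is too small and would only give a sample complexity of order \<open>sqrt n\<close>.\<close>

definition bump :: "real \<Rightarrow> real \<Rightarrow> real" where
  "bump L t = max 0 (1 - sqrt (\<bar>t\<bar> / L))"

lemma bump_le_1: "L > 0 \<Longrightarrow> bump L t \<le> 1"
  by (simp add: bump_def)

lemma bump_nonneg: "bump L t \<ge> 0"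
  by (simp add: bump_def)

lemma bump_eq_0_iff: "L > 0 \<Longrightarrow> bump L t = 0 \<longleftrightarrow> L \<le> \<bar>t\<bar>"
  by (simp add: bump_def max_def)

lemma bump_inside: "L > 0 \<Longrightarrow> \<bar>t\<bar> \<le> L \<Longrightarrow> bump L t = 1 - sqrt (\<bar>t\<bar> / L)"
  by (simp add: bump_def)

lemma bump_0 [simp]: "bump L 0 = 1"
  by (simp add: bump_def)

lemma bump_minus: "bump L (- t) = bump L t"
  by (simp add: bump_def)

text \<open>The increment of the square root from t to t + 1 is at most 1 / sqrt (t + 1), and
  truncation at 0 does not enlarge it. Squared, these bounds sum to a harmonic series.\<close>

lemma bump_step_square:
  assumes L: "L > 0"
  shows "(bump L (real t) - bump L (real (Suc t)))\<^sup>2 \<le> 1 / (L * real (Suc t))"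
proof -
  have "\<bar>bump L (real t) - bump L (real (Suc t))\<bar> \<le> sqrt (real (Suc t) / L) - sqrt (real t / L)"
  proof -
    have "sqrt (real t / L) \<le> sqrt (real (Suc t) / L)" using L by (simp add: divide_right_mono)
    then show ?thesis by (auto simp: bump_def max_def)
  qed
  also have "\<dots> \<le> 1 / sqrt (L * real (Suc t))"
  proof -
    have "sqrt (real t) * sqrt (real (Suc t)) \<ge> real t"
    proof -
      have "sqrt (real t) * sqrt (real t) \<le> sqrt (real t) * sqrt (real (Suc t))" by (intro mult_left_mono) auto
      then show ?thesis by simp
    qed
    then have "(sqrt (real (Suc t)) - sqrt (real t)) * sqrt (real (Suc t)) \<le> 1"
      by (simp add: left_diff_distrib)
    then have "sqrt (real (Suc t)) - sqrt (real t) \<le> 1 / sqrt (real (Suc t))"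
      by (simp add: pos_le_divide_eq)
    then have "(sqrt (real (Suc t)) - sqrt (real t)) / sqrt L \<le> 1 / sqrt (real (Suc t)) / sqrt L"
      using L by (intro divide_right_mono) auto
    then show ?thesis by (simp add: real_sqrt_divide real_sqrt_mult diff_divide_distrib mult.commute)
  qed
  finally have "(bump L (real t) - bump L (real (Suc t)))\<^sup>2 \<le> (1 / sqrt (L * real (Suc t)))\<^sup>2"
    by (rule power2_le_iff_abs_le[THEN iffD2, rotated]) (use L in simp)
  also have "\<dots> = 1 / (L * real (Suc t))" using L by (simp add: power_one_over)
  finally show ?thesis .
qed

lemma bump_variation:
  assumes L: "L > 0" and "\<nu> < n"
  shows "(\<Sum>i<n. (bump L (real i + 1 - real \<nu>) - bump L (real i - real \<nu>))\<^sup>2) \<le> 2 * (1 + ln (real n)) / L"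
proof -
  let ?d = "\<lambda>i. (bump L (real i + 1 - real \<nu>) - bump L (real i - real \<nu>))\<^sup>2"
  let ?H = "(\<Sum>t<n. 1 / real (Suc t)) / L"
  \<comment> \<open>Both sides of the peak are counted outwards from \<nu>, the left one after
    reflection by \<open>bump_minus\<close>; each is at most a harmonic sum.\<close>
  have split: "{..<n} = {..<\<nu>} \<union> {\<nu>..<n}" using assms by auto
  have "(\<Sum>i<n. ?d i) = (\<Sum>i<\<nu>. ?d i) + (\<Sum>i\<in>{\<nu>..<n}. ?d i)"
    by (subst split, rule sum.union_disjoint) auto
  also have "(\<Sum>i<\<nu>. ?d i) = (\<Sum>t<\<nu>. ?d (\<nu> - Suc t))"
    by (rule sum.nat_diff_reindex[symmetric])
  also have "\<dots> \<le> (\<Sum>t<\<nu>. 1 / (L * real (Suc t)))"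
  proof (rule sum_mono)
    fix t assume "t \<in> {..<\<nu>}"
    then have "real (\<nu> - Suc t) + 1 - real \<nu> = - real t" "real (\<nu> - Suc t) - real \<nu> = - real (Suc t)" by auto
    then show "?d (\<nu> - Suc t) \<le> 1 / (L * real (Suc t))"
      using bump_step_square[OF L, of t] by (simp only: bump_minus)
  qed
  also have "\<dots> \<le> (\<Sum>t<n. 1 / (L * real (Suc t)))" using assms by (intro sum_mono2) auto
  also have "\<dots> = ?H" by (simp add: sum_divide_distrib mult.commute)
  also have "(\<Sum>i\<in>{\<nu>..<n}. ?d i) = (\<Sum>t<n - \<nu>. ?d (t + \<nu>))"
    using sum.shift_bounds_nat_ivl[of ?d 0 \<nu> "n - \<nu>"] assms by (simp add: atLeast0LessThan)
  also have "\<dots> \<le> (\<Sum>t<n - \<nu>. 1 / (L * real (Suc t)))"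
  proof (rule sum_mono)
    fix t
    have "real (t + \<nu>) + 1 - real \<nu> = real (Suc t)" "real (t + \<nu>) - real \<nu> = real t" by auto
    then show "?d (t + \<nu>) \<le> 1 / (L * real (Suc t))"
      using bump_step_square[OF L, of t] by (simp only: power2_commute)
  qed
  also have "\<dots> \<le> (\<Sum>t<n. 1 / (L * real (Suc t)))" using assms by (intro sum_mono2) auto
  also have "\<dots> = ?H" by (simp add: sum_divide_distrib mult.commute)
  finally have "(\<Sum>i<n. ?d i) \<le> 2 * ?H" by simp
  also have "\<dots> \<le> 2 * ((1 + ln (real n)) / L)"
    using harm_le_ln[of n] assms by (intro mult_left_mono divide_right_mono) auto
  finally show ?thesis by simp
qed

section \<open>The dual vector of several separated jumps\<close>

locale separated_jumps =
  fixes n :: nat and S :: "nat set" and L :: real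
  assumes L_ge_1: "L \<ge> 1"
    and S_subset: "S \<subseteq> {1..<n}"
    and separated: "\<And>a b. a \<in> S \<union> {0, n} \<Longrightarrow> b \<in> S \<union> {0, n} \<Longrightarrow> a < b \<Longrightarrow> 4 * L \<le> real b - real a"
begin

lemma finite_S: "finite S"
  using S_subset finite_subset by blast

lemma separated_abs:
  assumes "a \<in> S \<union> {0, n}" "b \<in> S \<union> {0, n}" "a \<noteq> b"
  shows "4 * L \<le> \<bar>real a - real b\<bar>"
  using separated[of a b] separated[of b a] assms by linarith

definition profile :: "(nat \<Rightarrow> real) \<Rightarrow> nat \<Rightarrow> real" where
  "profile \<sigma> i = (\<Sum>\<nu>\<in>S. \<sigma> \<nu> * bump L (real i - real \<nu>))"

text \<open>The margin L + 1 lets one jump serve both i and \<open>Suc i\<close> when increments are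
  estimated. By L \<ge> 1 and the gaps of 4 L, all other jumps are still at least L away.\<close>

lemma profile_near:
  assumes "\<nu> \<in> S" "\<bar>real i - real \<nu>\<bar> < L + 1"
  shows "profile \<sigma> i = \<sigma> \<nu> * bump L (real i - real \<nu>)"
proof -
  have "bump L (real i - real \<mu>) = 0" if "\<mu> \<in> S" "\<mu> \<noteq> \<nu>" for \<mu>
    using separated_abs[of \<mu> \<nu>] that assms L_ge_1 by (subst bump_eq_0_iff) auto
  then show ?thesis
    unfolding profile_def using assms finite_S by (subst sum.remove[of S \<nu>]) auto
qed

lemma abs_profile_near:
  assumes "\<nu> \<in> S" "\<bar>real i - real \<nu>\<bar> < L" "\<bar>\<sigma> \<nu>\<bar> = 1"
  shows "\<bar>profile \<sigma> i\<bar> = bump L (real i - real \<nu>)"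
  using assms by (subst profile_near[of \<nu>]) (auto simp: abs_mult bump_nonneg)

lemma profile_far:
  assumes "\<And>\<nu>. \<nu> \<in> S \<Longrightarrow> L \<le> \<bar>real i - real \<nu>\<bar>"
  shows "profile \<sigma> i = 0"
  unfolding profile_def using assms L_ge_1 by (intro sum.neutral) (auto simp: bump_eq_0_iff)

text \<open>The end points take part in the separation condition, so no bump reaches them; this
  removes the boundary terms of the summation by parts.\<close>

lemma profile_ends: "profile \<sigma> 0 = 0" "profile \<sigma> n = 0"
proof -
  have "L \<le> \<bar>real 0 - real \<nu>\<bar>" "L \<le> \<bar>real n - real \<nu>\<bar>" if "\<nu> \<in> S" for \<nu>
    using separated_abs[of 0 \<nu>] separated_abs[of n \<nu>] that S_subset L_ge_1 by force+
  then show "profile \<sigma> 0 = 0" "profile \<sigma> n = 0" by (auto intro!: profile_far)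
qed

lemma profile_jump: "\<nu> \<in> S \<Longrightarrow> profile \<sigma> \<nu> = \<sigma> \<nu>"
  using profile_near[of \<nu> \<nu>] L_ge_1 by simp

text \<open>At most one bump moves at each index, so there are no cross terms and the energies of
  the single bumps add up.\<close>

lemma profile_variation:
  assumes \<sigma>: "\<And>\<nu>. \<nu> \<in> S \<Longrightarrow> \<bar>\<sigma> \<nu>\<bar> \<le> 1"
  shows "(\<Sum>i<n. (profile \<sigma> (Suc i) - profile \<sigma> i)\<^sup>2) \<le> 2 * real (card S) * (1 + ln (real n)) / L"
proof -
  let ?d = "\<lambda>\<nu> i. (bump L (real i + 1 - real \<nu>) - bump L (real i - real \<nu>))\<^sup>2"
  have "(profile \<sigma> (Suc i) - profile \<sigma> i)\<^sup>2 \<le> (\<Sum>\<nu>\<in>S. ?d \<nu> i)" for i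
  proof (cases "\<exists>\<nu>\<in>S. \<bar>real i - real \<nu>\<bar> < L \<or> \<bar>real (Suc i) - real \<nu>\<bar> < L")
    case True
    then obtain \<nu> where \<nu>: "\<nu> \<in> S" "\<bar>real i - real \<nu>\<bar> < L + 1" "\<bar>real (Suc i) - real \<nu>\<bar> < L + 1" by force
    have "(profile \<sigma> (Suc i) - profile \<sigma> i)\<^sup>2 = (\<sigma> \<nu>)\<^sup>2 * ?d \<nu> i"
      using \<nu> by (simp add: profile_near[of \<nu>] right_diff_distrib[symmetric] power_mult_distrib add.commute)
    also have "\<dots> \<le> 1 * ?d \<nu> i"
      using \<sigma>[OF \<nu>(1)] by (intro mult_right_mono) (auto simp: abs_square_le_1)
    also have "\<dots> \<le> (\<Sum>\<nu>\<in>S. ?d \<nu> i)"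
      using \<nu>(1) finite_S by (simp, intro member_le_sum) auto
    finally show ?thesis .
  next
    case False
    then have "profile \<sigma> (Suc i) = 0" "profile \<sigma> i = 0" by (auto intro!: profile_far simp: not_less)
    then show ?thesis by (simp add: sum_nonneg)
  qed
  then have "(\<Sum>i<n. (profile \<sigma> (Suc i) - profile \<sigma> i)\<^sup>2) \<le> (\<Sum>i<n. \<Sum>\<nu>\<in>S. ?d \<nu> i)"
    by (rule sum_mono)
  also have "\<dots> = (\<Sum>\<nu>\<in>S. \<Sum>i<n. ?d \<nu> i)" by (rule sum.swap)
  also have "\<dots> \<le> (\<Sum>\<nu>\<in>S. 2 * (1 + ln (real n)) / L)"
    using L_ge_1 S_subset by (intro sum_mono bump_variation) auto
  finally show ?thesis by (simp add: ac_simps)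
qed

lemma summation_by_parts:
  "(\<Sum>i\<in>{1..<n}. profile \<sigma> i * (h i - h (i - 1))) = (\<Sum>i<n. (profile \<sigma> i - profile \<sigma> (Suc i)) * h i)"
proof -
  \<comment> \<open>For general k a boundary term at k remains, which makes the induction work; it
    vanishes at k = n by \<open>profile_ends\<close>.\<close>
  have *: "(\<Sum>i<k. (profile \<sigma> i - profile \<sigma> (Suc i)) * h i)
     = (\<Sum>i\<in>{1..<k}. profile \<sigma> i * (h i - h (i - 1))) - profile \<sigma> k * h (k - 1)" if "k \<ge> 1" for k
    using that
  proof (induction k rule: dec_induct)
    case base
    then show ?case by (simp add: profile_ends left_diff_distrib)
  next
    case (step k)
    then show ?case by (simp add: algebra_simps)
  qed
  show ?thesis
  proof (cases "n \<ge> 1")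
    case True
    from *[OF this] show ?thesis by (simp add: profile_ends)
  qed (simp add: not_le)
qed

text \<open>The profile equals \<sigma> on S, so subtracting its pairing with the gradient of h
  cancels the jump terms of the descent inequality and leaves the gaps 1 - |profile| off S.
  Summation by parts moves the difference onto the profile, where Cauchy-Schwarz meets its small
  energy.\<close>

lemma weighted_gradient_bound:
  assumes \<sigma>: "\<And>\<nu>. \<nu> \<in> S \<Longrightarrow> \<bar>\<sigma> \<nu>\<bar> \<le> 1"
    and desc: "(\<Sum>i\<in>{1..<n} - S. \<bar>h i - h (i - 1)\<bar>) + (\<Sum>\<nu>\<in>S. \<sigma> \<nu> * (h \<nu> - h (\<nu> - 1))) \<le> 0"
  shows "(\<Sum>i\<in>{1..<n} - S. (1 - \<bar>profile \<sigma> i\<bar>) * \<bar>h i - h (i - 1)\<bar>)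
    \<le> sqrt (2 * real (card S) * (1 + ln (real n)) / L) * sqrt (norm_sq n h)"
proof -
  let ?g = "\<lambda>i. h i - h (i - 1)" and ?v = "profile \<sigma>"
  have "(\<Sum>i\<in>{1..<n}. ?v i * ?g i) = (\<Sum>i\<in>S. \<sigma> i * ?g i) + (\<Sum>i\<in>{1..<n} - S. ?v i * ?g i)"
    using S_subset sum.subset_diff[of S "{1..<n}" "\<lambda>i. ?v i * ?g i"] by (simp add: profile_jump)
  moreover have "(\<Sum>i\<in>{1..<n} - S. ?v i * ?g i) \<le> (\<Sum>i\<in>{1..<n} - S. \<bar>?v i\<bar> * \<bar>?g i\<bar>)"
    by (intro sum_mono) (simp only: abs_mult[symmetric] abs_ge_self)
  ultimately have "(\<Sum>i\<in>{1..<n} - S. (1 - \<bar>?v i\<bar>) * \<bar>?g i\<bar>) \<le> - (\<Sum>i\<in>{1..<n}. ?v i * ?g i)"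
    using desc by (simp add: left_diff_distrib sum_subtractf)
  also have "\<dots> = (\<Sum>i<n. (?v (Suc i) - ?v i) * h i)"
    unfolding summation_by_parts sum_negf[symmetric] by (simp add: left_diff_distrib)
  also have "\<dots> \<le> sqrt (2 * real (card S) * (1 + ln (real n)) / L * norm_sq n h)"
  proof (rule real_le_rsqrt)
    have "(\<Sum>i<n. (?v (Suc i) - ?v i) * h i)\<^sup>2 \<le> (\<Sum>i<n. (?v (Suc i) - ?v i)\<^sup>2) * (\<Sum>i<n. (h i)\<^sup>2)"
      by (rule Cauchy_Schwarz_ineq_sum)
    also have "\<dots> \<le> 2 * real (card S) * (1 + ln (real n)) / L * norm_sq n h"
      unfolding norm_sq_def using \<sigma> by (intro mult_right_mono profile_variation sum_nonneg) auto
    finally show "(\<Sum>i<n. (?v (Suc i) - ?v i) * h i)\<^sup>2 \<le> 2 * real (card S) * (1 + ln (real n)) / L * norm_sq n h" .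
  qed
  finally show ?thesis by (simp add: real_sqrt_mult[symmetric])
qed

end

section \<open>Descent directions of the total variation\<close>

context separated_jumps
begin

text \<open>Partition points at dyadic distances from the jumps and on a grid of width about \<open>L\<close>:
  a block is never longer than its distance to the jumps, nor than \<open>2 * L\<close>.\<close>

definition dyadic :: "nat set" where
  "dyadic = {e. \<exists>j. e = 2 ^ j \<and> e \<le> n}"

definition mesh :: nat where
  "mesh = nat \<lceil>L\<rceil>"

definition points :: "nat set" where
  "points = ({0, n} \<union> S \<union> (\<lambda>(\<nu>, e). \<nu> + e) ` (S \<times> dyadic) \<union> (\<lambda>(\<nu>, e). \<nu> - e) ` (S \<times> dyadic)
     \<union> (\<lambda>t. t * mesh) ` {..n div mesh}) \<inter> {..n}"

lemma mesh: "mesh > 0" "L \<le> real mesh" "real mesh \<le> 2 * L"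
  using L_ge_1 by (auto simp: mesh_def) linarith+

lemma partition_points_points: "partition_points n points"
  by unfold_locales (auto simp: points_def)

lemma card_dyadic:
  assumes "n > 0"
  shows "finite dyadic" "real (card dyadic) \<le> log 2 (real n) + 1"
proof -
  define k where "k = nat \<lfloor>log 2 (real n)\<rfloor>"
  have sub: "dyadic \<subseteq> (\<lambda>j. 2 ^ j) ` {..k}"
  proof
    fix e assume "e \<in> dyadic"
    then obtain j where j: "e = 2 ^ j" "2 ^ j \<le> n" by (auto simp: dyadic_def)
    then have "real j \<le> log 2 (real n)" using assms by (simp add: le_log_iff powr_realpow)
    then have "j \<le> k" by (simp add: k_def le_nat_floor)
    with j show "e \<in> (\<lambda>j. 2 ^ j) ` {..k}" by auto
  qed
  then show "finite dyadic" by (rule finite_subset) simp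
  have "card dyadic \<le> card ((\<lambda>j. 2 ^ j :: nat) ` {..k})" using sub by (intro card_mono) auto
  also have "\<dots> \<le> k + 1" using card_image_le[of "{..k}" "\<lambda>j. 2 ^ j :: nat"] by simp
  finally have "real (card dyadic) \<le> real k + 1" by simp
  also have "real k \<le> log 2 (real n)" using assms by (simp add: k_def)
  finally show "real (card dyadic) \<le> log 2 (real n) + 1" by simp
qed

lemma card_points:
  assumes "n > 0"
  shows "real (card points) \<le> 3 + real (card S) + 2 * real (card S) * (log 2 (real n) + 1) + real n / L"
proof -
  let ?P = "(\<lambda>(\<nu>, e). \<nu> + e) ` (S \<times> dyadic)" and ?M = "(\<lambda>(\<nu>, e). \<nu> - e) ` (S \<times> dyadic)"
    and ?T = "(\<lambda>t. t * mesh) ` {..n div mesh}"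
  have fin: "finite (S \<times> dyadic)" using finite_S card_dyadic[OF assms] by simp
  have "card points \<le> card ({0, n} \<union> S \<union> ?P \<union> ?M \<union> ?T)"
    unfolding points_def using fin finite_S by (intro card_mono) auto
  also have "\<dots> \<le> card ({0, n} \<union> S \<union> ?P \<union> ?M) + card ?T" by (rule card_Un_le)
  also have "card ({0, n} \<union> S \<union> ?P \<union> ?M) \<le> card ({0, n} \<union> S \<union> ?P) + card ?M" by (rule card_Un_le)
  also have "card ({0, n} \<union> S \<union> ?P) \<le> card ({0, n} \<union> S) + card ?P" by (rule card_Un_le)
  also have "card ({0, n} \<union> S) \<le> card {0, n} + card S" by (rule card_Un_le)
  also have "card {0, n} \<le> 2" by (simp add: card_insert_if)
  also have "card ?P \<le> card (S \<times> dyadic)" by (rule card_image_le[OF fin])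
  also have "card ?M \<le> card (S \<times> dyadic)" by (rule card_image_le[OF fin])
  also have "card ?T \<le> n div mesh + 1" using card_image_le[of "{..n div mesh}" "\<lambda>t. t * mesh"] by simp
  finally have "card points \<le> 3 + card S + 2 * (card S * card dyadic) + n div mesh"
    by (simp add: card_cartesian_product)
  then have "real (card points) \<le> real (3 + card S + 2 * (card S * card dyadic) + n div mesh)"
    by (rule of_nat_mono)
  also have "\<dots> = 3 + real (card S) + 2 * real (card S) * real (card dyadic) + real (n div mesh)"
    by simp
  also have "real (n div mesh) \<le> real n / real mesh" by (rule of_nat_div_le_of_nat)
  also have "\<dots> \<le> real n / L" using mesh L_ge_1 by (intro divide_left_mono) auto
  also have "2 * real (card S) * real (card dyadic) \<le> 2 * real (card S) * (log 2 (real n) + 1)"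
    using card_dyadic[OF assms] by (intro mult_left_mono) auto
  finally show ?thesis by simp
qed

lemma block_le_mesh:
  assumes "p < n"
  shows "next_point points p - p \<le> mesh"
proof -
  interpret partition_points n points by (rule partition_points_points)
  define q where "q = (p div mesh + 1) * mesh"
  have q: "p < q" "q \<le> p + mesh"
    using mesh(1) dividend_less_div_times[of mesh p] by (auto simp: q_def)
  have "next_point points p \<le> q"
  proof (cases "q \<le> n")
    case True
    then have "p div mesh + 1 \<le> n div mesh"
      using mesh(1) unfolding q_def by (simp add: less_eq_div_iff_mult_less_eq)
    then have "q \<in> (\<lambda>t. t * mesh) ` {..n div mesh}" unfolding q_def by (intro imageI) simp
    then have "q \<in> points" using True by (simp add: points_def)
    then show ?thesis using q by (intro next_point_le)
  next
    case False
    then show ?thesis using next_point(3)[OF assms] by simp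
  qed
  with q show ?thesis by simp
qed

text \<open>If d is the distance and 2^j \<le> d < 2^(j+1), the cuts at distances 2^j and 2^(j+1) on
  the side of i enclose the block, whose length is thus at most 2^j. Since i is strictly inside a
  block, it is no partition point, in particular not \<nu>, where d would be 0.\<close>

lemma block_le_dist:
  assumes p: "p \<in> points" "p < n" "p < i" "i < next_point points p" and \<nu>: "\<nu> \<in> S"
  shows "real (next_point points p - p) \<le> \<bar>real i - real \<nu>\<bar>"
proof -
  interpret partition_points n points by (rule partition_points_points)
  let ?N = "next_point points p"
  have iQ: "q \<le> p \<or> ?N \<le> q" if "q \<in> points" for q
    using next_point_le[OF that, of p] by force
  have "?N \<le> n" "\<nu> < n" using next_point[OF p(2)] \<nu> S_subset by auto
  have "\<nu> \<in> points" using \<nu> \<open>\<nu> < n\<close> by (auto simp: points_def)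
  then have "i \<noteq> \<nu>" using iQ p by force
  define d where "d = (if \<nu> < i then i - \<nu> else \<nu> - i)"
  have "d > 0" using \<open>i \<noteq> \<nu>\<close> by (auto simp: d_def)
  then obtain j where j: "2 ^ j \<le> d" "d < 2 ^ (j + 1)" using ex_power_ivl1[of 2 d] by auto
  have "d \<le> n" using \<open>\<nu> < n\<close> \<open>?N \<le> n\<close> p by (auto simp: d_def)
  then have dy: "2 ^ j \<in> dyadic" using j by (auto simp: dyadic_def)
  have dy': "2 * 2 ^ j \<in> dyadic" if "2 * 2 ^ j \<le> n"
    using that unfolding dyadic_def by (auto intro!: exI[of _ "Suc j"])
  have "?N - p \<le> 2 ^ j"
  proof (cases "\<nu> < i")
    case True
    then have d: "d = i - \<nu>" by (simp add: d_def)
    have "\<nu> + 2 ^ j \<in> points" unfolding points_def using \<nu> dy j d True \<open>?N \<le> n\<close> p by force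
    then have 1: "\<nu> + 2 ^ j \<le> p" using iQ[of "\<nu> + 2 ^ j"] j d True p by auto
    have "?N \<le> \<nu> + 2 * 2 ^ j"
    proof (cases "\<nu> + 2 * 2 ^ j \<le> n")
      case True
      then have "\<nu> + 2 * 2 ^ j \<in> points" unfolding points_def using \<nu> dy' by force
      then show ?thesis using j d p by (intro next_point_le) auto
    qed (use \<open>?N \<le> n\<close> in simp)
    with 1 show ?thesis by simp
  next
    case False
    then have d: "d = \<nu> - i" by (simp add: d_def)
    have "\<nu> - 2 ^ j \<in> points" unfolding points_def using \<nu> dy \<open>\<nu> < n\<close> by force
    moreover have "p < \<nu> - 2 ^ j" using j(1) d p False \<open>d > 0\<close> by auto
    ultimately have 1: "?N \<le> \<nu> - 2 ^ j" by (rule next_point_le)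
    have "\<nu> - 2 * 2 ^ j \<in> points"
    proof (cases "2 * 2 ^ j \<le> n")
      case True
      then show ?thesis unfolding points_def using \<nu> dy' \<open>\<nu> < n\<close> by force
    next
      case False
      \<comment> \<open>A distance beyond n is not in \<open>dyadic\<close>, but truncated
        subtraction yields 0, which is a partition point.\<close>
      then have "\<nu> - 2 * 2 ^ j = 0" using \<open>\<nu> < n\<close> by simp
      then show ?thesis using zero_in by simp
    qed
    moreover have "\<nu> - 2 * 2 ^ j \<le> i" using j d False by auto
    ultimately have "\<nu> - 2 * 2 ^ j \<le> p" using iQ[of "\<nu> - 2 * 2 ^ j"] p by auto
    with 1 show ?thesis by simp
  qed
  also have "\<dots> \<le> d" by (rule j)
  finally have "real (?N - p) \<le> real d" by (rule of_nat_mono)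
  also have "real d = \<bar>real i - real \<nu>\<bar>" by (auto simp: d_def)
  finally show ?thesis .
qed

text \<open>At distance d < L from a jump the right side is sqrt (2 d), and the block has length at
  most d. Away from all jumps it is sqrt (2 L), where the 2 pays for rounding L up to
  \<open>mesh\<close>.\<close>

lemma block_weight:
  assumes \<sigma>: "\<And>\<nu>. \<nu> \<in> S \<Longrightarrow> \<bar>\<sigma> \<nu>\<bar> = 1"
    and p: "p \<in> points" "p < n" "p < i" "i < next_point points p"
  shows "sqrt (real (next_point points p - p)) \<le> sqrt (2 * L) * (1 - \<bar>profile \<sigma> i\<bar>)"
proof (cases "\<exists>\<nu>\<in>S. \<bar>real i - real \<nu>\<bar> < L")
  case True
  then obtain \<nu> where \<nu>: "\<nu> \<in> S" "\<bar>real i - real \<nu>\<bar> < L" by blast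
  then have "\<bar>profile \<sigma> i\<bar> = bump L (real i - real \<nu>)" by (intro abs_profile_near \<sigma>)
  also have "\<dots> = 1 - sqrt (\<bar>real i - real \<nu>\<bar> / L)"
    using \<nu> L_ge_1 by (intro bump_inside) auto
  finally have "sqrt (2 * L) * (1 - \<bar>profile \<sigma> i\<bar>) = sqrt (2 * \<bar>real i - real \<nu>\<bar>)"
    using L_ge_1 by (simp add: real_sqrt_mult[symmetric])
  then show ?thesis
    using block_le_dist[OF p \<nu>(1)] by simp
next
  case False
  then have "profile \<sigma> i = 0" by (auto intro!: profile_far simp: not_less)
  moreover have "real (next_point points p - p) \<le> 2 * L"
    using block_le_mesh[OF p(2)] mesh by (meson of_nat_mono order_trans)
  ultimately show ?thesis by simp
qed

lemma descent_step_coeff_bound: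
  assumes \<sigma>: "\<And>\<nu>. \<nu> \<in> S \<Longrightarrow> \<bar>\<sigma> \<nu>\<bar> = 1"
    and desc: "(\<Sum>i\<in>{1..<n} - S. \<bar>h i - h (i - 1)\<bar>) + (\<Sum>\<nu>\<in>S. \<sigma> \<nu> * (h \<nu> - h (\<nu> - 1))) \<le> 0"
  shows "(\<Sum>i<n. \<bar>step_coeff points h i\<bar> * sqrt (real (next_point points i - i)))
    \<le> (sqrt (real (card points)) + 4 * sqrt (real (card S) * (1 + ln (real n)))) * sqrt (norm_sq n h)"
proof -
  interpret partition_points n points by (rule partition_points_points)
  let ?W = "\<lambda>i. sqrt (2 * L) * (1 - \<bar>profile \<sigma> i\<bar>)"
  have profile_le: "\<bar>profile \<sigma> i\<bar> \<le> 1" for i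
  proof (cases "\<exists>\<nu>\<in>S. \<bar>real i - real \<nu>\<bar> < L")
    case True
    then obtain \<nu> where \<nu>: "\<nu> \<in> S" "\<bar>real i - real \<nu>\<bar> < L" by blast
    then have "\<bar>profile \<sigma> i\<bar> = bump L (real i - real \<nu>)" by (intro abs_profile_near \<sigma>)
    then show ?thesis using bump_le_1[of L] L_ge_1 by simp
  next
    case False
    then have "profile \<sigma> i = 0" by (auto intro!: profile_far simp: not_less)
    then show ?thesis by simp
  qed
  have "S \<subseteq> points" using S_subset by (auto simp: points_def)
  have "(\<Sum>i<n. \<bar>step_coeff points h i\<bar> * sqrt (real (next_point points i - i)))
     \<le> sqrt (real (card points)) * sqrt (norm_sq n h) + 2 * (\<Sum>i\<in>{1..<n} - points. ?W i * \<bar>h i - h (i - 1)\<bar>)"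
    by (rule step_coeff_bound) (rule block_weight[OF \<sigma>])
  also have "(\<Sum>i\<in>{1..<n} - points. ?W i * \<bar>h i - h (i - 1)\<bar>) \<le> (\<Sum>i\<in>{1..<n} - S. ?W i * \<bar>h i - h (i - 1)\<bar>)"
    using \<open>S \<subseteq> points\<close> profile_le L_ge_1 by (intro sum_mono2) auto
  also have "\<dots> = sqrt (2 * L) * (\<Sum>i\<in>{1..<n} - S. (1 - \<bar>profile \<sigma> i\<bar>) * \<bar>h i - h (i - 1)\<bar>)"
    by (simp add: sum_distrib_left mult.assoc)
  also have "\<dots> \<le> sqrt (2 * L) * (sqrt (2 * real (card S) * (1 + ln (real n)) / L) * sqrt (norm_sq n h))"
    using \<sigma> desc L_ge_1 by (intro mult_left_mono weighted_gradient_bound) auto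
  also have "\<dots> = sqrt (2 * L * (2 * real (card S) * (1 + ln (real n)) / L)) * sqrt (norm_sq n h)"
    by (simp only: real_sqrt_mult[symmetric] mult.assoc)
  \<comment> \<open>The scale L of the weight cancels against the 1 / L of the energy.\<close>
  also have "2 * L * (2 * real (card S) * (1 + ln (real n)) / L) = 2\<^sup>2 * (real (card S) * (1 + ln (real n)))"
    using L_ge_1 by simp
  also have "sqrt \<dots> = 2 * sqrt (real (card S) * (1 + ln (real n)))"
    by (simp add: real_sqrt_mult)
  finally show ?thesis by (simp add: algebra_simps)
qed

end

section \<open>The descent inequality\<close>

lemma tv_norm_eq: "tv_norm n x = (\<Sum>i\<in>{1..<n}. \<bar>x i - x (i - 1)\<bar>)"
proof -
  have "(\<Sum>i\<in>{1..<n}. \<bar>x i - x (i - 1)\<bar>) = (\<Sum>i\<in>{0..<n - 1}. \<bar>x (Suc i) - x i\<bar>)"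
    by (cases n) (simp_all add: sum.shift_bounds_Suc_ivl del: sum.op_ivl_Suc)
  then show ?thesis by (simp add: tv_norm_def atLeast0LessThan)
qed

text \<open>Subgradient inequality |a + b| \<ge> |a| + sgn a * b at each jump; elsewhere xs has no
  increment, so x and h have the same one.\<close>

lemma descent_direction:
  assumes "tv_norm n x \<le> tv_norm n xs"
  defines "h \<equiv> \<lambda>j. x j - xs j" and "S \<equiv> jumps n xs"
  shows "(\<Sum>i\<in>{1..<n} - S. \<bar>h i - h (i - 1)\<bar>) + (\<Sum>\<nu>\<in>S. sgn (xs \<nu> - xs (\<nu> - 1)) * (h \<nu> - h (\<nu> - 1))) \<le> 0"
proof -
  have S: "S \<subseteq> {1..<n}" by (auto simp: S_def jumps_def)
  have split: "(\<Sum>i\<in>{1..<n}. f i) = (\<Sum>i\<in>{1..<n} - S. f i) + (\<Sum>i\<in>S. f i)" for f :: "nat \<Rightarrow> real"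
    using S by (intro sum.subset_diff) auto
  let ?D = "\<lambda>x i. x i - x (i - 1)"
  have zero: "?D xs i = 0" if "i \<in> {1..<n} - S" for i using that by (auto simp: S_def jumps_def)
  have "(\<Sum>i\<in>{1..<n} - S. \<bar>?D h i\<bar>) + (\<Sum>i\<in>S. \<bar>?D xs i\<bar> + sgn (?D xs i) * ?D h i)
    \<le> (\<Sum>i\<in>{1..<n} - S. \<bar>?D x i\<bar>) + (\<Sum>i\<in>S. \<bar>?D x i\<bar>)"
  proof (intro add_mono sum_mono)
    fix i assume "i \<in> {1..<n} - S"
    from zero[OF this] show "\<bar>?D h i\<bar> \<le> \<bar>?D x i\<bar>" by (simp add: h_def)
  next
    fix i
    show "\<bar>?D xs i\<bar> + sgn (?D xs i) * ?D h i \<le> \<bar>?D x i\<bar>"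
      by (auto simp: h_def sgn_if)
  qed
  also have "\<dots> = tv_norm n x" unfolding tv_norm_eq split ..
  also have "\<dots> \<le> tv_norm n xs" by fact
  also have "\<dots> = (\<Sum>i\<in>S. \<bar>?D xs i\<bar>)" unfolding tv_norm_eq split using zero by simp
  finally show ?thesis by (simp add: sum.distrib)
qed

section \<open>Consequences of separation\<close>

lemma delta_separated_gap:
  assumes sep: "delta_separated n \<Delta> xs" and n: "n > 0"
    and ab: "a \<in> jumps n xs \<union> {0, n}" "b \<in> jumps n xs \<union> {0, n}" "a < b"
  shows "real n * \<Delta> / (real (card (jumps n xs)) + 1) \<le> real b - real a"
proof -
  let ?P = "jumps n xs \<union> {0, n}"
  have "finite ?P" by (auto simp: jumps_def)
  \<comment> \<open>The assumption speaks of consecutive points only; c is the successor of a, and b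
    is not before it.\<close>
  define c where "c = Min {c \<in> ?P. a < c}"
  have c: "c \<in> ?P" "a < c" "\<And>d. d \<in> ?P \<Longrightarrow> a < d \<Longrightarrow> c \<le> d"
  proof -
    have Z: "finite {c \<in> ?P. a < c}" "{c \<in> ?P. a < c} \<noteq> {}" using ab \<open>finite ?P\<close> by auto
    from Min_in[OF this] show "c \<in> ?P" "a < c" unfolding c_def by blast+
    show "c \<le> d" if "d \<in> ?P" "a < d" for d unfolding c_def using Z(1) that by (intro Min_le) auto
  qed
  then have "(real c - real a) / real n \<ge> \<Delta> / (real (card (jumps n xs)) + 1)"
    using sep ab unfolding delta_separated_def Let_def by (meson not_le)
  then have "real n * (\<Delta> / (real (card (jumps n xs)) + 1)) \<le> real c - real a"
    using n by (simp add: pos_le_divide_eq mult.commute)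
  also have "\<dots> \<le> real b - real a" using c(3)[OF ab(2,3)] by simp
  finally show ?thesis by simp
qed

text \<open>Pigeonhole: points at mutual distance at least G lie in different cells of length
  G.\<close>

lemma card_separated_le:
  fixes P :: "nat set"
  assumes P: "P \<subseteq> {..n}" and G: "G > 0"
    and sep: "\<And>a b. a \<in> P \<Longrightarrow> b \<in> P \<Longrightarrow> a < b \<Longrightarrow> G \<le> real b - real a"
  shows "real (card P) \<le> real n / G + 1"
proof -
  let ?f = "\<lambda>p. nat \<lfloor>real p / G\<rfloor>"
  have less: "?f a < ?f b" if "a \<in> P" "b \<in> P" "a < b" for a b
  proof -
    have "(real a + G) / G \<le> real b / G" using sep[OF that] G by (intro divide_right_mono) auto
    then have "real a / G + 1 \<le> real b / G" using G by (simp add: add_divide_distrib)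
    then have "\<lfloor>real a / G\<rfloor> + 1 \<le> \<lfloor>real b / G\<rfloor>" by linarith
    moreover have "0 \<le> \<lfloor>real a / G\<rfloor>" using G by simp
    ultimately show ?thesis by linarith
  qed
  have "inj_on ?f P"
  proof (rule inj_onI, rule ccontr)
    fix a b assume "a \<in> P" "b \<in> P" "?f a = ?f b" "a \<noteq> b"
    then show False using less[of a b] less[of b a] by (cases "a < b") auto
  qed
  moreover have "?f ` P \<subseteq> {..nat \<lfloor>real n / G\<rfloor>}"
    using P G by (auto intro!: nat_mono floor_mono divide_right_mono)
  ultimately have "card P \<le> card {..nat \<lfloor>real n / G\<rfloor>}" by (intro card_inj_on_le) auto
  then have "real (card P) \<le> real (nat \<lfloor>real n / G\<rfloor>) + 1" by simp
  also have "real (nat \<lfloor>real n / G\<rfloor>) \<le> real n / G" using G by simp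
  finally show ?thesis by simp
qed

text \<open>The s + 1 gaps, each at least n \<Delta> / (s + 1), must fit into n. The bound serves to
  absorb s into s / \<Delta>.\<close>

lemma delta_separated_le_1:
  assumes sep: "delta_separated n \<Delta> xs" and n: "n > 0" and \<Delta>: "\<Delta> > 0"
  shows "\<Delta> \<le> 1"
proof -
  let ?s = "real (card (jumps n xs))"
  have fin: "finite (jumps n xs)" by (auto simp: jumps_def)
  have "card (jumps n xs \<union> {0, n}) = card (jumps n xs) + 2"
    using n fin by (subst card_Un_disjoint) (auto simp: jumps_def)
  moreover have "real (card (jumps n xs \<union> {0, n})) \<le> real n / (real n * \<Delta> / (?s + 1)) + 1"
    using delta_separated_gap[OF sep n] n \<Delta>
    by (intro card_separated_le) (auto simp: jumps_def add_nonneg_pos)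
  ultimately have "?s + 1 \<le> (?s + 1) / \<Delta>" using n by simp
  then show ?thesis using \<Delta> by (simp add: pos_le_divide_eq mult_le_cancel_left1)
qed

section \<open>Constants and conclusion\<close>

lemma sparsity_budget:
  fixes n :: nat and s \<Delta> L Q :: real
  assumes n: "n \<ge> 2" and s: "s \<ge> 1" and \<Delta>: "0 < \<Delta>" "\<Delta> \<le> 1"
    and L: "L = real n * \<Delta> / (s + 1) / 4"
    and Q: "0 \<le> Q" "Q \<le> 3 + s + 2 * s * (log 2 (real n) + 1) + real n / L"
  shows "(sqrt Q + 4 * sqrt (s * (1 + ln (real n))))\<^sup>2 \<le> 128 * (s * ln (real n) / \<Delta>)"
    and "1 \<le> 3 / 2 * (s * ln (real n) / \<Delta>)"
proof -
  define \<Lambda> where "\<Lambda> = ln (real n)"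
  define T where "T = s * \<Lambda> / \<Delta>"
  have "2 / 3 \<le> ln (2::real)" by (rule ln2_ge_two_thirds)
  also have "ln 2 \<le> \<Lambda>" using n by (simp add: \<Lambda>_def)
  finally have \<Lambda>: "\<Lambda> \<ge> 2 / 3" .
  have "s \<le> s / \<Delta>" using s \<Delta> by (simp add: pos_le_divide_eq mult_left_le)
  have sT: "s / \<Delta> \<le> 3 / 2 * T"
  proof -
    have "s / \<Delta> * (2 / 3) \<le> s / \<Delta> * \<Lambda>" using s \<Delta> \<Lambda> by (intro mult_left_mono) auto
    also have "s / \<Delta> * \<Lambda> = T" by (simp add: T_def)
    finally have "s / \<Delta> * (2 / 3) \<le> T" .
    moreover have "x * (2 / 3) \<le> y \<Longrightarrow> x \<le> 3 / 2 * y" for x y :: real by linarith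
    ultimately show ?thesis by blast
  qed
  have s\<Lambda>: "s * \<Lambda> \<le> T" using s \<Delta> \<Lambda> by (simp add: T_def pos_le_divide_eq mult_left_le)
  have log: "s * log 2 (real n) \<le> 3 / 2 * (s * \<Lambda>)"
  proof -
    have "\<Lambda> / ln 2 \<le> \<Lambda> / (2 / 3)" using \<Lambda> ln2_ge_two_thirds by (intro divide_left_mono) auto
    then have "log 2 (real n) \<le> 3 / 2 * \<Lambda>" by (simp add: log_def \<Lambda>_def)
    then have "s * log 2 (real n) \<le> s * (3 / 2 * \<Lambda>)" using s by (intro mult_left_mono) auto
    then show ?thesis by simp
  qed
  have "real n / L = 4 * (s + 1) / \<Delta>" unfolding L using n s \<Delta> by simp
  also have "\<dots> \<le> 8 * (s / \<Delta>)" using s \<Delta> by (simp add: divide_right_mono)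
  finally have nL: "real n / L \<le> 8 * (s / \<Delta>)" .
  have "Q \<le> 3 + s + (2 * (s * log 2 (real n)) + 2 * s) + real n / L"
    using Q(2) by (simp add: algebra_simps)
  \<comment> \<open>The terms 3, 3 s and n / L amount to at most 14 s / \<Delta> \<le> 21 T, and the
    logarithmic term to at most 3 T.\<close>
  also have "\<dots> \<le> 24 * T" using s \<open>s \<le> s / \<Delta>\<close> sT s\<Lambda> log nL by linarith
  finally have QT: "Q \<le> 24 * T" .
  have sum: "s * (1 + \<Lambda>) \<le> 5 / 2 * T"
    using \<open>s \<le> s / \<Delta>\<close> sT s\<Lambda> unfolding distrib_left by linarith
  have sum0: "s * (1 + \<Lambda>) \<ge> 0" using s \<Lambda> by simp
  have "(a + 4 * b)\<^sup>2 \<le> 2 * a\<^sup>2 + 32 * b\<^sup>2" for a b :: real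
    using zero_le_power2[of "a - 4 * b"] by (simp add: power2_eq_square algebra_simps)
  from this[of "sqrt Q" "sqrt (s * (1 + \<Lambda>))"]
  have "(sqrt Q + 4 * sqrt (s * (1 + \<Lambda>)))\<^sup>2 \<le> 2 * Q + 32 * (s * (1 + \<Lambda>))"
    using Q(1) sum0 by simp
  \<comment> \<open>128 = 2 * 24 + 32 * 5/2.\<close>
  also have "\<dots> \<le> 128 * T" using QT sum by linarith
  finally show "(sqrt Q + 4 * sqrt (s * (1 + ln (real n))))\<^sup>2 \<le> 128 * (s * ln (real n) / \<Delta>)"
    by (simp add: \<Lambda>_def T_def)
  have "1 \<le> 3 / 2 * T" using s \<open>s \<le> s / \<Delta>\<close> sT by linarith
  then show "1 \<le> 3 / 2 * (s * ln (real n) / \<Delta>)" by (simp add: \<Lambda>_def T_def)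
qed

lemma unique_tv_minimizer_probability:
  fixes n :: nat and xs :: "nat \<Rightarrow> real"
  defines "s \<equiv> real (card (jumps n xs))"
  assumes n: "n \<ge> 2" and s: "card (jumps n xs) > 0" and \<Delta>: "\<Delta> > 0"
    and sep: "delta_separated n \<Delta> xs" and \<Delta>_ge: "\<Delta> \<ge> 8 * s / real n"
    and u: "u > 0" and m: "real m \<ge> 20000 * (s * (ln (real n))\<^sup>2 / \<Delta> + u\<^sup>2)"
  shows "measure (gaussian_matrix m n) {A \<in> space (gaussian_matrix m n). unique_tv_minimizer m n A xs}
    \<ge> 1 - exp (- u\<^sup>2 / 2)"
proof -
  define S where "S = jumps n xs"
  define L where "L = real n * \<Delta> / (s + 1) / 4"
  define T where "T = s * ln (real n) / \<Delta>"
  have s1: "s \<ge> 1" using s by (simp add: s_def)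
  have \<Delta>1: "\<Delta> \<le> 1" using delta_separated_le_1[OF sep _ \<Delta>] n by simp
  have L1: "L \<ge> 1"
  proof -
    \<comment> \<open>The assumption \<Delta> \<ge> 8 s / n is exactly what makes the bump width L
      at least one index.\<close>
    have "4 * (s + 1) \<le> 8 * s" using s1 by simp
    also have "\<dots> \<le> real n * \<Delta>" using \<Delta>_ge n by (simp add: pos_divide_le_eq mult.commute)
    finally show ?thesis using s1 by (simp add: L_def pos_le_divide_eq)
  qed
  interpret separated_jumps n S L
  proof
    show "4 * L \<le> real b - real a" if "a \<in> S \<union> {0, n}" "b \<in> S \<union> {0, n}" "a < b" for a b
    proof -
      have "4 * (x / 4) = x" for x :: real by simp
      then have "4 * L = real n * \<Delta> / (s + 1)" unfolding L_def .
      then show ?thesis using delta_separated_gap[OF sep _ that[unfolded S_def]] n by (simp add: s_def)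
    qed
  qed (use L1 in \<open>auto simp: S_def jumps_def\<close>)
  interpret partition_points n points by (rule partition_points_points)
  define \<psi> where "\<psi> i j = 1 / sqrt (real (next_point points i - i)) * step_fun points i j" for i j
  define R where "R = (sqrt (real (card points)) + 4 * sqrt (real (card S) * (1 + ln (real n))))\<^sup>2"
  have sS: "real (card S) = s" by (simp add: s_def S_def)
  have "real (card points) \<le> 3 + s + 2 * s * (log 2 (real n) + 1) + real n / L"
    using card_points n by (simp add: sS)
  note budget = sparsity_budget[OF n s1 \<Delta> \<Delta>1 L_def _ this, folded T_def]
  have RT: "R \<le> 128 * T" using budget by (simp add: R_def sS)
  have T1: "1 \<le> 3 / 2 * T" using budget by simp
  \<comment> \<open>4096 = 32 * 128 comes from \<open>RT\<close>; the summand 2 makes k - 1 exceed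
    32 R strictly.\<close>
  define k where "k = nat \<lceil>4096 * T\<rceil> + 2"
  have k: "k > 0" "32 * R < real k - 1" "real k + 1 \<le> 4102 * T"
  proof -
    have "real (nat \<lceil>4096 * T\<rceil>) \<ge> 4096 * T" by (rule real_nat_ceiling_ge)
    then show "32 * R < real k - 1" using RT by (simp add: k_def)
    have "real (nat \<lceil>4096 * T\<rceil>) \<le> 4096 * T + 1" using T1 by linarith
    moreover have "real k = real (nat \<lceil>4096 * T\<rceil>) + 2" by (simp only: k_def of_nat_add of_nat_numeral)
    \<comment> \<open>Rounding and constants add up to 4, and 4 \<le> 6 T by
      \<open>T1\<close>.\<close>
    ultimately show "real k + 1 \<le> 4102 * T" using T1 by linarith
  qed (simp add: k_def)
  have m_ge: "u\<^sup>2 + 2 * (real k + 1) * ln (2 * real n) \<le> real m"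
  proof -
    have "ln (2 * real n) \<le> 2 * ln (real n)"
      using n by (simp add: ln_mult)
    \<comment> \<open>The second logarithm enters here. The resulting 16408 = 2 * 4102 * 2 lies
      below the constant 20000 of the theorem.\<close>
    then have "2 * (real k + 1) * ln (2 * real n) \<le> 2 * (4102 * T) * (2 * ln (real n))"
      using k(3) T1 n by (intro mult_mono) auto
    also have "\<dots> = 16408 * (s * (ln (real n))\<^sup>2 / \<Delta>)" by (simp add: T_def power2_eq_square)
    also have "\<dots> \<le> 20000 * (s * (ln (real n))\<^sup>2 / \<Delta>)" using s1 \<Delta> by (intro mult_right_mono) auto
    finally show ?thesis using m zero_le_power2[of u] unfolding distrib_left by linarith
  qed
  have "0 < u\<^sup>2" using u by simp
  moreover have "0 \<le> 2 * (real k + 1) * ln (2 * real n)" using n by simp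
  ultimately have m0: "0 < m" using m_ge by linarith
  have len: "real (next_point points i - i) > 0" if "i < n" for i using next_point(2)[OF that] by simp
  have unit: "norm_sq n (\<psi> i) = 1" if "i < n" for i
    unfolding \<psi>_def[abs_def] norm_sq_scale norm_sq_step_fun[OF that]
    using len[OF that] by (simp add: power_one_over)
  have good: "unique_tv_minimizer m n A xs"
    if lower: "\<And>ps. length ps = k \<Longrightarrow> set ps \<subseteq> {..<n} \<times> {-1, 1} \<Longrightarrow>
         img_sq m n A (signed_combination \<psi> ps) \<ge> real m / 8 * norm_sq n (signed_combination \<psi> ps)"
      and upper: "\<And>i. i < n \<Longrightarrow> img_sq m n A (\<psi> i) \<le> 4 * real m" for A
    unfolding unique_tv_minimizer_def
  proof (intro allI impI, elim conjE, rule ccontr)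
    fix x assume Ax: "matvec m n A x = matvec m n A xs" and ne: "\<exists>j<n. x j \<noteq> xs j"
      and "\<not> tv_norm n xs < tv_norm n x"
    define h where "h j = x j - xs j" for j
    \<comment> \<open>The norm of each step function is moved into its coefficient, since the atoms
      \<psi> have unit norm.\<close>
    define c where "c i = step_coeff points h i * sqrt (real (next_point points i - i))" for i
    have "(\<Sum>i\<in>{1..<n} - S. \<bar>h i - h (i - 1)\<bar>) + (\<Sum>\<nu>\<in>S. sgn (xs \<nu> - xs (\<nu> - 1)) * (h \<nu> - h (\<nu> - 1))) \<le> 0"
      unfolding h_def S_def by (rule descent_direction) (use \<open>\<not> tv_norm n xs < tv_norm n x\<close> in simp)
    moreover have "\<bar>sgn (xs \<nu> - xs (\<nu> - 1))\<bar> = 1" if "\<nu> \<in> S" for \<nu>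
      using that by (auto simp: S_def jumps_def abs_sgn_eq)
    ultimately have bound: "(\<Sum>i<n. \<bar>step_coeff points h i\<bar> * sqrt (real (next_point points i - i)))
       \<le> (sqrt (real (card points)) + 4 * sqrt (real (card S) * (1 + ln (real n)))) * sqrt (norm_sq n h)"
      using descent_step_coeff_bound[of "\<lambda>\<nu>. sgn (xs \<nu> - xs (\<nu> - 1))" h] by blast
    have "img_sq m n A h \<noteq> 0"
    proof (rule kernel_avoids_atomic_ball[where I = "{..<n}" and \<psi> = \<psi> and c = c and R = R and k = k])
      show "h j = (\<Sum>i\<in>{..<n}. c i * \<psi> i j)" if "j < n" for j
        unfolding step_decomposition[OF that, of h]
      proof (rule sum.cong)
        fix i assume "i \<in> {..<n}"
        then have "sqrt (real (next_point points i - i)) \<noteq> 0" using len[of i] by simp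
        then show "step_coeff points h i * step_fun points i j = c i * \<psi> i j"
          unfolding c_def \<psi>_def by (simp only: mult.assoc) simp
      qed simp
      have "(\<Sum>i\<in>{..<n}. \<bar>c i\<bar>) \<le> sqrt R * sqrt (norm_sq n h)"
        using bound n by (simp add: c_def abs_mult R_def)
      then have "(\<Sum>i\<in>{..<n}. \<bar>c i\<bar>)\<^sup>2 \<le> (sqrt R * sqrt (norm_sq n h))\<^sup>2"
        by (intro power_mono sum_nonneg) auto
      also have "\<dots> = R * norm_sq n h"
        using norm_sq_nonneg[of n h] by (simp add: power_mult_distrib R_def)
      finally show "(\<Sum>i\<in>{..<n}. \<bar>c i\<bar>)\<^sup>2 \<le> R * norm_sq n h" .
      show "norm_sq n h > 0" using ne by (simp add: norm_sq_pos_iff h_def)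
    qed (use lower upper k m0 in auto)
    then show False using Ax unfolding matvec_eq_iff_img_sq h_def by simp
  qed
  show ?thesis
    by (rule signed_atoms_good_probability[OF m0 unit m_ge _ k(1) measurable_unique_tv_minimizer])
       (use n good in auto)
qed

theorem theorem1:
  "\<exists>C::real. C > 0 \<and>
     (\<forall>(n::nat) (xs::nat \<Rightarrow> real) (\<Delta>::real) (u::real) (m::nat).
        n \<ge> 2 \<longrightarrow> card (jumps n xs) > 0 \<longrightarrow> \<Delta> > 0 \<longrightarrow>
        delta_separated n \<Delta> xs \<longrightarrow>
        \<Delta> \<ge> 8 * real (card (jumps n xs)) / real n \<longrightarrow>
        u > 0 \<longrightarrow>
        real m \<ge> C * (real (card (jumps n xs)) * (ln (real n))\<^sup>2 / \<Delta> + u\<^sup>2) \<longrightarrow>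
        measure (gaussian_matrix m n)
          {A \<in> space (gaussian_matrix m n). unique_tv_minimizer m n A xs}
          \<ge> 1 - exp (- u\<^sup>2 / 2))"
proof (intro exI[of _ 20000] conjI allI impI)
  show "(0::real) < 20000" by simp
qed (rule unique_tv_minimizer_probability)

end
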